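(* For every positive integer $t$, there exists a (topologically) finitely generated prosoluble group $G$ such that the graph $\Delta_{\mathrm{virt}}(G)$ has precisely $t$ connected components.
   Context: For a profinite group $G$, the virtually generating graph $\Gamma_{\mathrm{virt}}(G)$ is the (simple) graph whose vertices are the elements of $G$ and in which two vertices $x$ and $y$ are adjacent if and only if the closed subgroup $\langle x,y\rangle$ topologically generated by $x$ and $y$ is open in $G$. The graph $\Delta_{\mathrm{virt}}(G)$ is the subgraph of $\Gamma_{\mathrm{virt}}(G)$ obtained by removing its isolated vertices. *)

theory Defs
  imports "HOL-Analysis.Analysis" "HOL-Algebra.Algebra" "Graph_Theory.Graph_Theory"
begin

locale topological_group = group G for G :: "('a, 'b) monoid_scheme" (structure) +
  fixes T :: "'a topology"
  assumes topspace_eq: "topspace T = carrier G"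
    and continuous_mult: "continuous_map (prod_topology T T) T (\<lambda>(x, y). x \<otimes> y)"
    and continuous_inv: "continuous_map T T (\<lambda>x. inv x)"

locale profinite_group = topological_group +
  assumes compact: "compact_space T"
    and Hausdorff: "Hausdorff_space T"
    and totally_disconnected: "\<And>C x y. connectedin T C \<Longrightarrow> x \<in> C \<Longrightarrow> y \<in> C \<Longrightarrow> x = y"

text \<open>A profinite group is the inverse limit of its quotients by open normal subgroups; it is
  prosoluble if these finite quotients are soluble.\<close>

locale prosoluble_group = profinite_group +
  assumes solvable_quotients: "\<And>N. N \<lhd> G \<Longrightarrow> openin T N \<Longrightarrow> solvable (G Mod N)"

definition closed_generate :: "('a, 'b) monoid_scheme \<Rightarrow> 'a topology \<Rightarrow> 'a set \<Rightarrow> 'a set" where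
  "closed_generate G T S = T closure_of (generate G S)"

text \<open>A topologically finitely generated profinite group has only countably many open normal
  subgroups, so it embeds as a closed subgroup in a countable product of finite groups. Hence each
  one has an isomorphic copy whose carrier is a set of functions \<^typ>\<open>nat \<Rightarrow> nat\<close>, and
  an existence statement over all such groups may be stated for that element type.\<close>

definition topologically_fin_gen :: "('a, 'b) monoid_scheme \<Rightarrow> 'a topology \<Rightarrow> bool" where
  "topologically_fin_gen G T \<longleftrightarrow>
    (\<exists>S. finite S \<and> S \<subseteq> carrier G \<and> closed_generate G T S = carrier G)"

text \<open>Simple graphs are encoded as loop-free symmetric digraphs without parallel arcs.\<close>

definition virt_generating_graph ::
    "('a, 'b) monoid_scheme \<Rightarrow> 'a topology \<Rightarrow> ('a, 'a \<times> 'a) pre_digraph" where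
  "virt_generating_graph G T = with_proj
    \<lparr> pverts = carrier G,
      parcs = {(x, y). x \<in> carrier G \<and> y \<in> carrier G \<and> x \<noteq> y \<and>
                 openin T (closed_generate G T {x, y})} \<rparr>"

lemma virt_generating_graph_simple:
  shows "loopfree_digraph (virt_generating_graph G T)"
    and "nomulti_digraph (virt_generating_graph G T)"
    and "sym_digraph (virt_generating_graph G T)"
  by unfold_locales
    (auto simp: virt_generating_graph_def arc_to_ends_def symmetric_conv insert_commute)

definition isolated_verts :: "('a, 'b) pre_digraph \<Rightarrow> 'a set" where
  "isolated_verts \<Gamma> = {v \<in> verts \<Gamma>. \<forall>w. (v, w) \<notin> arcs_ends \<Gamma> \<and> (w, v) \<notin> arcs_ends \<Gamma>}"

definition reduced_virt_generating_graph ::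
    "('a, 'b) monoid_scheme \<Rightarrow> 'a topology \<Rightarrow> ('a, 'a \<times> 'a) pre_digraph" where
  "reduced_virt_generating_graph G T =
    (let \<Gamma> = virt_generating_graph G T in induce_subgraph \<Gamma> (verts \<Gamma> - isolated_verts \<Gamma>))"

definition connected_components :: "('a, 'b) pre_digraph \<Rightarrow> ('a, 'b) pre_digraph set" where
  "connected_components \<Gamma> = {C. pre_digraph.max_subgraph \<Gamma> Digraph_Component.connected C}"

end

theory Submission
  imports Defs "HOL-Number_Theory.Cong"
begin

text \<open>
  Let \<open>K\<close> be the elementary abelian group of order \<open>2 ^ (2 * t)\<close>, thought of as \<open>t\<close> blocks of two bits.
  For every prime \<open>q \<ge> 5\<close> let \<open>K\<close> act on \<open>M q = (\<int>/q)\<^sup>3\<close> trivially on the first two coordinates \<open>u, v\<close> and by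
  a sign character on the third coordinate \<open>w\<close>, where the character is the parity of the bits in a
  set \<open>A\<close> that meets every block; each such \<open>A\<close> is used for infinitely many \<open>q\<close>. The group is the
  semidirect product of \<open>\<Prod>q. M q\<close> and \<open>K\<close>.

  The closed subgroup generated by \<open>x, y\<close> is open iff it contains \<open>M q\<close> for almost all \<open>q\<close>. Since two
  elements cannot generate \<open>(\<int>/q)\<^sup>3\<close>, no character may be trivial on both \<open>x\<close> and \<open>y\<close>, and a parity argument
  shows that the bits of \<open>x\<close> and \<open>y\<close> are then supported in one common block and linearly independent
  there. So adjacent vertices share a block. Conversely, two non-isolated vertices with the same
  block have a common neighbour, since for each \<open>q\<close> only a few values of \<open>u, v, w\<close> have to be avoided.
  Hence the components correspond to the \<open>t\<close> blocks.
\<close>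

section \<open>Products of cyclic groups twisted by signs\<close>

text \<open>The sign character of the bit group given by the parity of the bits in \<open>A\<close>.
  Its values are integers so that it can multiply digits directly.\<close>

definition twist :: "nat set \<Rightarrow> (nat \<Rightarrow> nat) \<Rightarrow> int" where
  "twist A f = (\<Prod>i\<in>A. (-1) ^ f i)"

text \<open>The semidirect product flattened into a single sequence of digits: \<open>f\<close> acts
  on digit \<open>j\<close> of \<open>g\<close> by the sign \<open>twist (c j) f\<close>. Residues
  are represented by naturals below \<open>m j\<close>, so that equality in the group is equality of
  functions.\<close>

definition twisted_product :: "(nat \<Rightarrow> nat) \<Rightarrow> (nat \<Rightarrow> nat set) \<Rightarrow> (nat \<Rightarrow> nat) monoid" where
  "twisted_product m c =
    \<lparr> carrier = {f. \<forall>j. f j < m j},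
      mult = (\<lambda>f g j. nat ((int (f j) + twist (c j) f * int (g j)) mod int (m j))),
      one = (\<lambda>_. 0) \<rparr>"

definition digit_topology :: "(nat \<Rightarrow> nat) \<Rightarrow> (nat \<Rightarrow> nat) topology" where
  "digit_topology m = product_topology (\<lambda>j. discrete_topology {..<m j}) UNIV"

lemma twist_empty [simp]: "twist {} f = 1"
  by (simp add: twist_def)

lemma twist_zero [simp]: "twist A (\<lambda>_. 0) = 1"
  by (simp add: twist_def)

lemma twist_sq [simp]: "twist A f * twist A f = 1"
  by (simp add: twist_def flip: prod.distrib power_add)

lemma twist_sq' [simp]: "twist A f * (twist A f * z) = z"
  by (simp flip: mult.assoc)

lemma twist_cases: "twist A f = 1 \<or> twist A f = -1"
  using twist_sq[of A f] by (metis power2_eq_1_iff power2_eq_square)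

lemma twist_cong: "(\<And>i. i \<in> A \<Longrightarrow> f i = g i) \<Longrightarrow> twist A f = twist A g"
  unfolding twist_def by (rule prod.cong) auto

lemma mod_add_mult_mod: "(x + s * (y mod M)) mod M = (x + s * y) mod (M :: int)"
  by (metis mod_add_right_eq mod_mult_right_eq)

lemma neg_one_power_mod_2: "(-1 :: int) ^ (n mod 2) = (-1) ^ n"
  by (cases "even n") auto

text \<open>The digits below \<open>b\<close> are the acting elementary abelian 2-group. Signs are
  read from these digits only, and these digits are themselves untwisted; this makes every sign a
  homomorphism and the multiplication associative.\<close>

locale twisted_digits =
  fixes m :: "nat \<Rightarrow> nat" and c :: "nat \<Rightarrow> nat set" and b :: nat
  assumes pos: "\<And>j. 0 < m j"
    and twisting_coords: "\<And>j. c j \<subseteq> {..<b}"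
    and binary: "\<And>j. j < b \<Longrightarrow> m j = 2"
    and untwisted: "\<And>j. j < b \<Longrightarrow> c j = {}"
begin

abbreviation "G \<equiv> twisted_product m c"
abbreviation "T \<equiv> digit_topology m"

lemma carrier_iff: "f \<in> carrier G \<longleftrightarrow> (\<forall>j. f j < m j)"
  by (simp add: twisted_product_def)

lemma carrierD: "f \<in> carrier G \<Longrightarrow> f j < m j"
  by (simp add: carrier_iff)

lemma one_eq: "\<one>\<^bsub>G\<^esub> = (\<lambda>_. 0)"
  by (simp add: twisted_product_def)

lemma mult_apply: "(f \<otimes>\<^bsub>G\<^esub> g) j = nat ((int (f j) + twist (c j) f * int (g j)) mod int (m j))"
  by (simp add: twisted_product_def)

lemma int_mult_apply:
  "int ((f \<otimes>\<^bsub>G\<^esub> g) j) = (int (f j) + twist (c j) f * int (g j)) mod int (m j)"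
  using pos[of j] by (simp add: mult_apply)

lemma mult_carrier: "f \<otimes>\<^bsub>G\<^esub> g \<in> carrier G"
  using pos by (auto simp: carrier_iff mult_apply nat_less_iff)

lemma one_carrier: "\<one>\<^bsub>G\<^esub> \<in> carrier G"
  using pos by (simp add: carrier_iff one_eq)

lemma mult_binary: "j < b \<Longrightarrow> (f \<otimes>\<^bsub>G\<^esub> g) j = (f j + g j) mod 2"
  using binary[of j] untwisted[of j] by (simp add: mult_apply nat_mod_distrib nat_add_distrib)

lemma twist_mult: "A \<subseteq> {..<b} \<Longrightarrow> twist A (f \<otimes>\<^bsub>G\<^esub> g) = twist A f * twist A g"
  unfolding twist_def prod.distrib[symmetric]
  by (rule prod.cong) (auto simp: mult_binary neg_one_power_mod_2 power_add)

lemma digit_eqI: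
  assumes "f \<in> carrier G" "g \<in> carrier G" "\<And>j. [int (f j) = int (g j)] (mod int (m j))"
  shows "f = g"
proof
  fix j
  show "f j = g j"
    using assms(3)[of j] carrierD[OF assms(1), of j] carrierD[OF assms(2), of j]
    by (simp add: cong_def)
qed

lemma group_G: "group G"
proof (rule groupI)
  fix x y z assume "x \<in> carrier G" "y \<in> carrier G" "z \<in> carrier G"
  show "x \<otimes>\<^bsub>G\<^esub> y \<otimes>\<^bsub>G\<^esub> z = x \<otimes>\<^bsub>G\<^esub> (y \<otimes>\<^bsub>G\<^esub> z)"
  proof (rule digit_eqI)
    fix j
    have "int ((x \<otimes>\<^bsub>G\<^esub> y \<otimes>\<^bsub>G\<^esub> z) j) =
        (int (x j) + twist (c j) x * int (y j) + twist (c j) x * twist (c j) y * int (z j)) mod int (m j)"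
      by (simp add: int_mult_apply twist_mult[OF twisting_coords] mod_simps)
    also have "\<dots> = int ((x \<otimes>\<^bsub>G\<^esub> (y \<otimes>\<^bsub>G\<^esub> z)) j)"
      by (simp add: int_mult_apply mod_add_mult_mod distrib_left add.assoc mult.assoc)
    finally show "[int ((x \<otimes>\<^bsub>G\<^esub> y \<otimes>\<^bsub>G\<^esub> z) j) = int ((x \<otimes>\<^bsub>G\<^esub> (y \<otimes>\<^bsub>G\<^esub> z)) j)] (mod int (m j))"
      by simp
  qed (auto simp: mult_carrier)
next
  fix x assume x: "x \<in> carrier G"
  then show "\<one>\<^bsub>G\<^esub> \<otimes>\<^bsub>G\<^esub> x = x"
    by (intro digit_eqI)
      (auto simp: mult_carrier int_mult_apply one_eq cong_def)
  \<comment> \<open>The digitwise solution of y * x = 1, provided that x and y have the same signs.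
    They do, since a bit is its own negative mod 2 (\<open>ybit\<close>).\<close>
  define y where "y = (\<lambda>j. nat ((- (twist (c j) x * int (x j))) mod int (m j)))"
  have y: "y \<in> carrier G"
    using pos by (auto simp: carrier_iff y_def nat_less_iff)
  have yj: "int (y j) = (- (twist (c j) x * int (x j))) mod int (m j)" for j
    using pos[of j] by (simp add: y_def)
  have ybit: "y j = x j" if "j < b" for j
  proof -
    have "x j = 0 \<or> x j = 1"
      using carrierD[OF x, of j] binary[OF that] by linarith
    then show ?thesis
      using binary[OF that] untwisted[OF that] by (auto simp: y_def)
  qed
  have "twist (c j) y = twist (c j) x" for j
    using twisting_coords[of j] by (intro twist_cong ybit) auto
  then have "y \<otimes>\<^bsub>G\<^esub> x = \<one>\<^bsub>G\<^esub>"
    by (intro digit_eqI) (auto simp: mult_carrier int_mult_apply one_carrier, auto simp: one_eq cong_def mod_simps yj)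
  with y show "\<exists>y\<in>carrier G. y \<otimes>\<^bsub>G\<^esub> x = \<one>\<^bsub>G\<^esub>"
    by blast
qed (auto simp: mult_carrier one_carrier)

sublocale group G
  by (rule group_G)

lemma twist_inv: "x \<in> carrier G \<Longrightarrow> A \<subseteq> {..<b} \<Longrightarrow> twist A (inv\<^bsub>G\<^esub> x) = twist A x"
  using twist_mult[of A "inv\<^bsub>G\<^esub> x" x] twist_cases[of A x] by (auto simp: one_eq)

lemma int_inv_apply:
  assumes "x \<in> carrier G"
  shows "int ((inv\<^bsub>G\<^esub> x) j) = (- (twist (c j) x * int (x j))) mod int (m j)"
proof -
  have "int ((x \<otimes>\<^bsub>G\<^esub> inv\<^bsub>G\<^esub> x) j) = 0"
    using assms by (simp add: one_eq)
  then have "[int (x j) + twist (c j) x * int ((inv\<^bsub>G\<^esub> x) j) = 0] (mod int (m j))"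
    by (simp add: int_mult_apply cong_def)
  \<comment> \<open>Multiplying by the sign, whose square is 1, isolates the digit of the
    inverse.\<close>
  then have "[twist (c j) x * (int (x j) + twist (c j) x * int ((inv\<^bsub>G\<^esub> x) j)) = twist (c j) x * 0] (mod int (m j))"
    by (rule cong_scalar_left)
  then have "[int ((inv\<^bsub>G\<^esub> x) j) = - (twist (c j) x * int (x j))] (mod int (m j))"
    by (simp add: algebra_simps cong_iff_dvd_diff)
  moreover have "(inv\<^bsub>G\<^esub> x) j < m j"
    using assms by (intro carrierD) auto
  ultimately show ?thesis
    by (simp add: cong_def)
qed

section \<open>The product topology in terms of initial segments of digits; profiniteness\<close>

lemma topspace_T: "topspace T = carrier G"
  by (auto simp: digit_topology_def carrier_iff PiE_iff)

text \<open>A basic open set restricts finitely many coordinates, and these all lie below some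
  \<open>N\<close>. From here on, closeness of two elements means agreement on an initial
  segment.\<close>

lemma openin_T_iff:
  "openin T U \<longleftrightarrow> U \<subseteq> carrier G \<and>
     (\<forall>f\<in>U. \<exists>N. \<forall>g\<in>carrier G. (\<forall>j<N. g j = f j) \<longrightarrow> g \<in> U)" (is "?L \<longleftrightarrow> ?R")
proof
  assume L: ?L
  show ?R
  proof (intro conjI ballI)
    show "U \<subseteq> carrier G"
      using openin_subset[OF L] topspace_T by simp
    fix f assume "f \<in> U"
    with L have "\<exists>V. finite {i. V i \<noteq> {..<m i}} \<and> f \<in> Pi\<^sub>E UNIV V \<and> Pi\<^sub>E UNIV V \<subseteq> U"
      unfolding digit_topology_def openin_product_topology_alt by simp blast
    then obtain V where V: "finite {i. V i \<noteq> {..<m i}}" "f \<in> Pi\<^sub>E UNIV V" "Pi\<^sub>E UNIV V \<subseteq> U"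
      by blast
    obtain N where "{i. V i \<noteq> {..<m i}} \<subseteq> {..<N}"
      using finite_nat_bounded[OF V(1)] by blast
    then have N: "V i = {..<m i}" if "\<not> i < N" for i
      using that by blast
    have "g \<in> U" if "g \<in> carrier G" "\<forall>j<N. g j = f j" for g
    proof -
      have "g i \<in> V i" for i
        using V(2) N[of i] that by (cases "i < N") (auto simp: PiE_iff carrier_iff)
      then show ?thesis
        using V(3) by auto
    qed
    then show "\<exists>N. \<forall>g\<in>carrier G. (\<forall>j<N. g j = f j) \<longrightarrow> g \<in> U"
      by blast
  qed
next
  assume R: ?R
  show ?L
    unfolding digit_topology_def openin_product_topology_alt
  proof
    fix f assume f: "f \<in> U"
    with R obtain N where N: "\<And>g. g \<in> carrier G \<Longrightarrow> (\<forall>j<N. g j = f j) \<Longrightarrow> g \<in> U"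
      by blast
    define V where "V = (\<lambda>j. if j < N then {f j} else {..<m j})"
    have f': "\<And>j. f j < m j"
      using f R by (auto simp: carrier_iff)
    have "finite {i. V i \<noteq> {..<m i}}"
      by (rule finite_subset[of _ "{..<N}"]) (auto simp: V_def)
    moreover have "Pi\<^sub>E UNIV V \<subseteq> U"
    proof
      fix g assume g: "g \<in> Pi\<^sub>E UNIV V"
      then have *: "g j \<in> V j" for j
        by auto
      have "g j < m j" for j
        using *[of j] f' by (auto simp: V_def split: if_splits)
      moreover have "\<forall>j<N. g j = f j"
        using * by (simp add: V_def) (metis singletonD)
      ultimately show "g \<in> U"
        by (intro N) (auto simp: carrier_iff)
    qed
    ultimately show "\<exists>U'. finite {i \<in> UNIV. U' i \<noteq> topspace (discrete_topology {..<m i})} \<and>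
        (\<forall>i\<in>UNIV. openin (discrete_topology {..<m i}) (U' i)) \<and> f \<in> Pi\<^sub>E UNIV U' \<and> Pi\<^sub>E UNIV U' \<subseteq> U"
      using f' by (intro exI[of _ V]) (auto simp: V_def)
  qed
qed

definition cylinder :: "(nat \<Rightarrow> nat) \<Rightarrow> nat \<Rightarrow> (nat \<Rightarrow> nat) set" where
  "cylinder f N = {g \<in> carrier G. \<forall>j<N. g j = f j}"

lemma openin_cylinder: "openin T (cylinder f N)"
  unfolding openin_T_iff cylinder_def by (auto intro!: exI[of _ N])

lemma closure_of_T_iff:
  assumes "S \<subseteq> carrier G"
  shows "f \<in> T closure_of S \<longleftrightarrow> f \<in> carrier G \<and> (\<forall>N. \<exists>g\<in>S. \<forall>j<N. g j = f j)"
proof (intro iffI conjI allI)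
  assume f: "f \<in> T closure_of S"
  then show f': "f \<in> carrier G"
    by (auto simp: in_closure_of topspace_T)
  fix N
  have "f \<in> cylinder f N"
    using f' by (simp add: cylinder_def)
  then have "\<exists>y. y \<in> S \<and> y \<in> cylinder f N"
    using f openin_cylinder[of f N] unfolding in_closure_of by blast
  then show "\<exists>g\<in>S. \<forall>j<N. g j = f j"
    by (auto simp: cylinder_def)
next
  assume f: "f \<in> carrier G \<and> (\<forall>N. \<exists>g\<in>S. \<forall>j<N. g j = f j)"
  show "f \<in> T closure_of S"
    unfolding in_closure_of topspace_T
  proof (intro conjI allI impI)
    fix U assume "f \<in> U \<and> openin T U"
    then obtain N where "\<forall>g\<in>carrier G. (\<forall>j<N. g j = f j) \<longrightarrow> g \<in> U"
      unfolding openin_T_iff by blast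
    with f assms show "\<exists>y. y \<in> S \<and> y \<in> U"
      by blast
  qed (use f in blast)
qed

text \<open>A digit of a product depends on the same digit of both factors and on the sign, which is
  read from the bits. Hence initial segments have to contain all bits, and \<open>max b N\<close>
  recurs below.\<close>

lemma mult_agree:
  assumes "b \<le> N" "\<forall>j<N. f j = f' j" "\<forall>j<N. g j = g' j" "j < N"
  shows "(f \<otimes>\<^bsub>G\<^esub> g) j = (f' \<otimes>\<^bsub>G\<^esub> g') j"
proof -
  have "twist (c j) f = twist (c j) f'"
    using assms twisting_coords[of j] by (intro twist_cong) auto
  then show ?thesis
    using assms by (simp add: mult_apply)
qed

lemma inv_agree:
  assumes "b \<le> N" "\<forall>j<N. f j = f' j" "j < N" "f \<in> carrier G" "f' \<in> carrier G"
  shows "(inv\<^bsub>G\<^esub> f) j = (inv\<^bsub>G\<^esub> f') j"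
proof -
  have "twist (c j) f = twist (c j) f'"
    using assms twisting_coords[of j] by (intro twist_cong) auto
  then have "int ((inv\<^bsub>G\<^esub> f) j) = int ((inv\<^bsub>G\<^esub> f') j)"
    using assms by (simp add: int_inv_apply)
  then show ?thesis
    by simp
qed

lemma continuous_map_T:
  assumes h: "\<And>x. x \<in> topspace S \<Longrightarrow> h x \<in> carrier G"
    and near: "\<And>x N. x \<in> topspace S \<Longrightarrow>
      \<exists>V. openin S V \<and> x \<in> V \<and> (\<forall>y\<in>V. \<forall>j<N. h y j = h x j)"
  shows "continuous_map S T h"
  unfolding continuous_map_def topspace_T
proof (intro conjI allI impI)
  fix U assume U: "openin T U"
  show "openin S {x \<in> topspace S. h x \<in> U}"
  proof (subst openin_subopen, intro ballI)
    fix x assume x: "x \<in> {x \<in> topspace S. h x \<in> U}"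
    with U obtain N where N: "\<forall>g\<in>carrier G. (\<forall>j<N. g j = h x j) \<longrightarrow> g \<in> U"
      unfolding openin_T_iff by blast
    from x near[of x N] obtain V where V: "openin S V" "x \<in> V" "\<forall>y\<in>V. \<forall>j<N. h y j = h x j"
      by blast
    have "V \<subseteq> {x \<in> topspace S. h x \<in> U}"
      using N V(3) h openin_subset[OF V(1)] by auto
    with V show "\<exists>V. openin S V \<and> x \<in> V \<and> V \<subseteq> {x \<in> topspace S. h x \<in> U}"
      by blast
  qed
qed (use h in auto)

lemma topological_group_G: "topological_group G T"
proof unfold_locales
  show "topspace T = carrier G"
    by (rule topspace_T)
  show "continuous_map (prod_topology T T) T (\<lambda>(x, y). x \<otimes>\<^bsub>G\<^esub> y)"
  proof (rule continuous_map_T)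
    fix z N assume z: "z \<in> topspace (prod_topology T T)"
    let ?V = "cylinder (fst z) (max b N) \<times> cylinder (snd z) (max b N)"
    have "openin (prod_topology T T) ?V"
      by (simp add: openin_prod_Times_iff openin_cylinder)
    moreover have "z \<in> ?V"
      using z by (auto simp: cylinder_def topspace_T)
    moreover have "(case y of (x, y) \<Rightarrow> x \<otimes>\<^bsub>G\<^esub> y) j = (case z of (x, y) \<Rightarrow> x \<otimes>\<^bsub>G\<^esub> y) j"
      if "y \<in> ?V" "j < N" for y j
      using that
      by (auto simp: cylinder_def split: prod.splits intro!: mult_agree[where N = "max b N"])
    ultimately show "\<exists>V. openin (prod_topology T T) V \<and> z \<in> V \<and>
        (\<forall>y\<in>V. \<forall>j<N. (case y of (x, y) \<Rightarrow> x \<otimes>\<^bsub>G\<^esub> y) j = (case z of (x, y) \<Rightarrow> x \<otimes>\<^bsub>G\<^esub> y) j)"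
      by blast
  qed (auto simp: mult_carrier)
  show "continuous_map T T (\<lambda>x. inv\<^bsub>G\<^esub> x)"
  proof (rule continuous_map_T)
    fix x N assume x: "x \<in> topspace T"
    then have "\<forall>y\<in>cylinder x (max b N). \<forall>j<N. (inv\<^bsub>G\<^esub> y) j = (inv\<^bsub>G\<^esub> x) j"
      by (auto simp: cylinder_def topspace_T intro!: inv_agree[where N = "max b N"])
    moreover have "x \<in> cylinder x (max b N)"
      using x by (simp add: cylinder_def topspace_T)
    ultimately show "\<exists>V. openin T V \<and> x \<in> V \<and> (\<forall>y\<in>V. \<forall>j<N. (inv\<^bsub>G\<^esub> y) j = (inv\<^bsub>G\<^esub> x) j)"
      using openin_cylinder by blast
  qed (auto simp: topspace_T)
qed

lemma compact_space_T: "compact_space T"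
  by (auto simp: digit_topology_def compact_space_product_topology compact_space_discrete_topology)

lemma profinite_group_G: "profinite_group G T"
proof -
  interpret topological_group G T
    by (rule topological_group_G)
  show ?thesis
  proof unfold_locales
    show "compact_space T"
      by (rule compact_space_T)
    show "Hausdorff_space T"
      by (auto simp: digit_topology_def Hausdorff_space_product_topology Hausdorff_space_discrete_topology)
    fix C x y assume C: "connectedin T C" "x \<in> C" "y \<in> C"
    show "x = y"
    proof
      fix j
      have "continuous_map T (discrete_topology {..<m j}) (\<lambda>f. f j)"
        unfolding digit_topology_def by (rule continuous_map_product_projection) simp
      then have "connectedin (discrete_topology {..<m j}) ((\<lambda>f. f j) ` C)"
        using C(1) by (rule connectedin_continuous_map_image)
      then show "x j = y j"
        using C(2,3) by (auto simp: connectedin_discrete_topology)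
    qed
  qed
qed

section \<open>Solubility via the abelian kernel of the projection to the bits\<close>

definition untwisted_part :: "(nat \<Rightarrow> nat) set" where
  "untwisted_part = {f \<in> carrier G. \<forall>j<b. f j = 0}"

lemma twist_untwisted: "f \<in> untwisted_part \<Longrightarrow> twist (c j) f = 1"
  using twisting_coords[of j] twist_cong[of "c j" f "\<lambda>_. 0"] by (auto simp: untwisted_part_def)

lemma inv_untwisted: "f \<in> untwisted_part \<Longrightarrow> inv\<^bsub>G\<^esub> f \<in> untwisted_part"
proof -
  assume f: "f \<in> untwisted_part"
  then have "int ((inv\<^bsub>G\<^esub> f) j) = 0" if "j < b" for j
    using that by (subst int_inv_apply) (auto simp: untwisted_part_def)
  with f show ?thesis
    by (auto simp: untwisted_part_def)
qed

lemma mult_untwisted: "f \<in> untwisted_part \<Longrightarrow> g \<in> untwisted_part \<Longrightarrow> f \<otimes>\<^bsub>G\<^esub> g \<in> untwisted_part"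
  by (auto simp: untwisted_part_def mult_carrier mult_binary)

lemma subgroup_untwisted: "subgroup untwisted_part G"
proof (rule subgroupI)
  show "untwisted_part \<noteq> {}"
    using one_carrier by (auto simp: untwisted_part_def one_eq)
qed (auto simp: inv_untwisted mult_untwisted, auto simp: untwisted_part_def)

lemma untwisted_commute:
  "f \<in> untwisted_part \<Longrightarrow> g \<in> untwisted_part \<Longrightarrow> f \<otimes>\<^bsub>G\<^esub> g = g \<otimes>\<^bsub>G\<^esub> f"
  by (intro digit_eqI) (auto simp: mult_carrier int_mult_apply twist_untwisted add.commute)

text \<open>The projection to the bits has an abelian image, so commutators lie in its
  kernel.\<close>

lemma commutator_untwisted:
  assumes "x \<in> carrier G" "y \<in> carrier G"
  shows "x \<otimes>\<^bsub>G\<^esub> y \<otimes>\<^bsub>G\<^esub> inv\<^bsub>G\<^esub> x \<otimes>\<^bsub>G\<^esub> inv\<^bsub>G\<^esub> y \<in> untwisted_part"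
proof -
  have "(x \<otimes>\<^bsub>G\<^esub> y \<otimes>\<^bsub>G\<^esub> inv\<^bsub>G\<^esub> x \<otimes>\<^bsub>G\<^esub> inv\<^bsub>G\<^esub> y) j = 0" if j: "j < b" for j
  proof -
    have "(x \<otimes>\<^bsub>G\<^esub> inv\<^bsub>G\<^esub> x) j = 0" "(y \<otimes>\<^bsub>G\<^esub> inv\<^bsub>G\<^esub> y) j = 0"
      using assms by (simp_all add: one_eq)
    then have "even (x j + (inv\<^bsub>G\<^esub> x) j)" "even (y j + (inv\<^bsub>G\<^esub> y) j)"
      using j by (auto simp: mult_binary)
    then have "even (x j + y j + (inv\<^bsub>G\<^esub> x) j + (inv\<^bsub>G\<^esub> y) j)"
      by auto
    then show ?thesis
      using j by (simp add: mult_binary mod_simps)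
  qed
  then show ?thesis
    by (simp add: untwisted_part_def mult_carrier)
qed

text \<open>The group is metabelian: \<open>untwisted_part\<close> contains all commutators and is
  itself abelian, so the second derived subgroup is trivial.\<close>

lemma solvable_G: "solvable G"
proof -
  have "derived G (carrier G) \<subseteq> untwisted_part"
    unfolding derived_def
    by (intro generate_subgroup_incl subgroup_untwisted) (auto simp: commutator_untwisted)
  then have "derived G (derived G (carrier G)) \<subseteq> derived G untwisted_part"
    using mono_derived subgroup.subset[OF subgroup_untwisted] by blast
  also have "\<dots> \<subseteq> {\<one>\<^bsub>G\<^esub>}"
    unfolding derived_def
  proof (intro generate_subgroup_incl)
    show "(\<Union>h1\<in>untwisted_part. \<Union>h2\<in>untwisted_part.
        {h1 \<otimes>\<^bsub>G\<^esub> h2 \<otimes>\<^bsub>G\<^esub> inv\<^bsub>G\<^esub> h1 \<otimes>\<^bsub>G\<^esub> inv\<^bsub>G\<^esub> h2}) \<subseteq> {\<one>\<^bsub>G\<^esub>}"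
    proof clarsimp
      fix h k assume hk: "h \<in> untwisted_part" "k \<in> untwisted_part"
      then have "h \<in> carrier G" "k \<in> carrier G"
        by (auto simp: untwisted_part_def)
      then show "h \<otimes>\<^bsub>G\<^esub> k \<otimes>\<^bsub>G\<^esub> inv\<^bsub>G\<^esub> h \<otimes>\<^bsub>G\<^esub> inv\<^bsub>G\<^esub> k = \<one>\<^bsub>G\<^esub>"
        by (simp add: untwisted_commute[OF hk] m_assoc)
    qed
  qed (rule triv_subgroup)
  finally have "(derived G ^^ 2) (carrier G) \<subseteq> {\<one>\<^bsub>G\<^esub>}"
    by (simp add: numeral_2_eq_2)
  moreover have "\<one>\<^bsub>G\<^esub> \<in> (derived G ^^ 2) (carrier G)"
    by (simp add: numeral_2_eq_2 derived_def generate.one)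
  ultimately show ?thesis
    unfolding solvable_iff_trivial_derived_seq by blast
qed

lemma prosoluble_group_G: "prosoluble_group G T"
proof -
  interpret profinite_group G T
    by (rule profinite_group_G)
  show ?thesis
  proof unfold_locales
    fix N assume "N \<lhd> G" 
    then interpret normal N G .
    interpret group_hom G "G Mod N" "(#>\<^bsub>G\<^esub>) N"
      by (simp add: group_hom_def group_hom_axioms_def factorgroup_is_group r_coset_hom_Mod)
    show "solvable (G Mod N)"
      by (rule surj_hom_imp_solvable[OF _ solvable_G]) (auto simp: FactGroup_def RCOSETS_def)
  qed
qed

section \<open>Closed generated subgroups: upper bounds, openness and finite generation\<close>

lemma subgroup_closed_generate:
  assumes S: "S \<subseteq> carrier G"
  shows "subgroup (closed_generate G T S) G"
proof -
  have gen: "generate G S \<subseteq> carrier G"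
    using S by (rule generate_incl)
  have mem: "f \<in> closed_generate G T S \<longleftrightarrow>
      f \<in> carrier G \<and> (\<forall>N. \<exists>g\<in>generate G S. \<forall>j<N. g j = f j)" for f
    unfolding closed_generate_def by (rule closure_of_T_iff[OF gen])
  show ?thesis
  proof (rule subgroupI)
    show "closed_generate G T S \<subseteq> carrier G"
      using mem by blast
    have "\<one>\<^bsub>G\<^esub> \<in> closed_generate G T S"
      unfolding mem using generate.one[of G S] one_closed by blast
    then show "closed_generate G T S \<noteq> {}"
      by blast
  next
    fix f assume f: "f \<in> closed_generate G T S"
    show "inv\<^bsub>G\<^esub> f \<in> closed_generate G T S"
      unfolding mem
    proof (intro conjI allI)
      show "inv\<^bsub>G\<^esub> f \<in> carrier G"
        using f mem by simp
      fix N
      obtain g where g: "g \<in> generate G S" "\<forall>j<max b N. g j = f j"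
        using f mem by metis
      moreover have "inv\<^bsub>G\<^esub> g \<in> generate G S"
        using generate_m_inv_closed[OF S g(1)] .
      ultimately show "\<exists>g\<in>generate G S. \<forall>j<N. g j = (inv\<^bsub>G\<^esub> f) j"
        using f gen mem
        by (intro bexI[of _ "inv\<^bsub>G\<^esub> g"]) (auto intro!: inv_agree[where N = "max b N"])
    qed
  next
    fix f f' assume f: "f \<in> closed_generate G T S" "f' \<in> closed_generate G T S"
    show "f \<otimes>\<^bsub>G\<^esub> f' \<in> closed_generate G T S"
      unfolding mem
    proof (intro conjI allI)
      show "f \<otimes>\<^bsub>G\<^esub> f' \<in> carrier G"
        by (rule mult_carrier)
      fix N
      obtain g g' where g: "g \<in> generate G S" "\<forall>j<max b N. g j = f j"
          "g' \<in> generate G S" "\<forall>j<max b N. g' j = f' j"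
        using f mem by metis
      then show "\<exists>g\<in>generate G S. \<forall>j<N. g j = (f \<otimes>\<^bsub>G\<^esub> f') j"
        by (intro bexI[of _ "g \<otimes>\<^bsub>G\<^esub> g'"])
          (auto intro!: mult_agree[where N = "max b N"] generate.eng)
    qed
  qed
qed

text \<open>Membership in \<open>Q\<close> is decided by finitely many digits, so \<open>Q\<close>
  is closed. This is the means of showing that a closed generated subgroup is small.\<close>

lemma closed_generate_subset:
  assumes Q: "subgroup Q G" "S \<subseteq> Q"
    and clopen: "\<And>f g. f \<in> Q \<Longrightarrow> g \<in> carrier G \<Longrightarrow> \<forall>j<N. f j = g j \<Longrightarrow> g \<in> Q"
  shows "closed_generate G T S \<subseteq> Q"
proof -
  have S: "S \<subseteq> carrier G"
    using Q subgroup.subset by blast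
  have gen: "generate G S \<subseteq> Q"
    using generate_subgroup_incl[OF Q(2,1)] .
  show ?thesis
    unfolding closed_generate_def subset_eq
    using closure_of_T_iff[OF generate_incl[OF S]] gen clopen by (metis subsetD)
qed

lemma generate_subset_closed_generate:
  "S \<subseteq> carrier G \<Longrightarrow> generate G S \<subseteq> closed_generate G T S"
  unfolding closed_generate_def
  using generate_incl[of S] by (intro closure_of_subset) (simp add: topspace_T)

text \<open>A subgroup is open as soon as it contains a neighbourhood of the identity: if
  \<open>g\<close> is close to \<open>f\<close>, then the quotient of \<open>g\<close> by
  \<open>f\<close> is close to the identity.\<close>

lemma openin_closed_generate_iff:
  assumes S: "S \<subseteq> carrier G"
  shows "openin T (closed_generate G T S) \<longleftrightarrow>
    (\<exists>N. \<forall>g\<in>carrier G. (\<forall>j<N. g j = 0) \<longrightarrow> g \<in> closed_generate G T S)" (is "_ \<longleftrightarrow> ?R")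
proof
  interpret H: subgroup "closed_generate G T S" G
    by (rule subgroup_closed_generate[OF S])
  show ?R if "openin T (closed_generate G T S)"
    using that H.one_closed unfolding openin_T_iff by (auto simp: one_eq)
  assume ?R
  then obtain N where N: "\<And>g. g \<in> carrier G \<Longrightarrow> \<forall>j<N. g j = 0 \<Longrightarrow> g \<in> closed_generate G T S"
    by blast
  show "openin T (closed_generate G T S)"
    unfolding openin_T_iff
  proof (intro conjI ballI exI impI)
    fix f g assume f: "f \<in> closed_generate G T S" and g: "g \<in> carrier G"
      and eq: "\<forall>j<max b N. g j = f j"
    have f': "f \<in> carrier G"
      using f by (rule H.mem_carrier)
    have "(inv\<^bsub>G\<^esub> f \<otimes>\<^bsub>G\<^esub> g) j = (inv\<^bsub>G\<^esub> f \<otimes>\<^bsub>G\<^esub> f) j" if "j < N" for j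
      using that eq by (intro mult_agree[where N = "max b N"]) auto
    then have "\<forall>j<N. (inv\<^bsub>G\<^esub> f \<otimes>\<^bsub>G\<^esub> g) j = 0"
      using f' by (simp add: one_eq)
    then have "inv\<^bsub>G\<^esub> f \<otimes>\<^bsub>G\<^esub> g \<in> closed_generate G T S"
      by (intro N mult_carrier)
    then have "f \<otimes>\<^bsub>G\<^esub> (inv\<^bsub>G\<^esub> f \<otimes>\<^bsub>G\<^esub> g) \<in> closed_generate G T S"
      by (rule H.m_closed[OF f])
    then show "g \<in> closed_generate G T S"
      using f' g by (simp flip: m_assoc)
  qed (rule H.subset)
qed

text \<open>The open subgroup contains every element that vanishes below \<open>N\<close>. The
  finite set \<open>R\<close> of elements supported below \<open>M\<close> meets all of its cosets,
  the truncation of \<open>f\<close> lying in the coset of \<open>f\<close>; so \<open>S\<close> and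
  \<open>R\<close> together generate.\<close>

lemma topologically_fin_gen_G:
  assumes S: "S \<subseteq> carrier G" "finite S" and op: "openin T (closed_generate G T S)"
  shows "topologically_fin_gen G T"
proof -
  define H where "H = closed_generate G T S"
  interpret H: subgroup H G
    unfolding H_def by (rule subgroup_closed_generate[OF S(1)])
  obtain N where N: "\<And>g. g \<in> carrier G \<Longrightarrow> \<forall>j<N. g j = 0 \<Longrightarrow> g \<in> H"
    using op openin_closed_generate_iff[OF S(1)] unfolding H_def by blast
  define M where "M = max b N"
  define R where "R = {f \<in> carrier G. \<forall>j\<ge>M. f j = 0}"
  have "finite R"
  proof (rule finite_subset)
    show "R \<subseteq> {f. \<forall>j. (j \<in> {..<M} \<longrightarrow> f j \<in> {..Max (m ` {..<M})}) \<and> (j \<notin> {..<M} \<longrightarrow> f j = 0)}"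
    proof (clarsimp simp: R_def carrier_iff)
      fix f j assume "\<forall>j. f j < m j" "j < M"
      then have "f j \<le> m j" "m j \<le> Max (m ` {..<M})"
        by (auto intro!: Max_ge less_imp_le)
      then show "f j \<le> Max (m ` {..<M})"
        by linarith
    qed
    show "finite {f. \<forall>j. (j \<in> {..<M} \<longrightarrow> f j \<in> {..Max (m ` {..<M})}) \<and> (j \<notin> {..<M} \<longrightarrow> f j = (0::nat))}"
      by (rule finite_set_of_finite_funs) auto
  qed
  define K where "K = closed_generate G T (S \<union> R)"
  have SR: "S \<union> R \<subseteq> carrier G"
    using S by (auto simp: R_def)
  interpret K: subgroup K G
    unfolding K_def by (rule subgroup_closed_generate[OF SR])
  have "H \<subseteq> K"
    unfolding H_def K_def closed_generate_def
    by (intro closure_of_mono mono_generate) auto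
  have "carrier G \<subseteq> K"
  proof
    fix f assume f: "f \<in> carrier G"
    define r where "r = (\<lambda>j. if j < M then f j else 0)"
    have r: "r \<in> R"
      using f pos by (auto simp: R_def r_def carrier_iff)
    then have r': "r \<in> carrier G"
      using SR by blast
    have "(inv\<^bsub>G\<^esub> r \<otimes>\<^bsub>G\<^esub> f) j = (inv\<^bsub>G\<^esub> r \<otimes>\<^bsub>G\<^esub> r) j" if "j < M" for j
      using that by (intro mult_agree[where N = M]) (auto simp: M_def r_def)
    then have "inv\<^bsub>G\<^esub> r \<otimes>\<^bsub>G\<^esub> f \<in> H"
      using r' by (intro N mult_carrier) (simp add: one_eq M_def)
    then have "inv\<^bsub>G\<^esub> r \<otimes>\<^bsub>G\<^esub> f \<in> K"
      using \<open>H \<subseteq> K\<close> by blast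
    have "r \<in> K"
      using r generate_subset_closed_generate[OF SR] by (auto simp: K_def intro: generate.incl)
    have "r \<otimes>\<^bsub>G\<^esub> (inv\<^bsub>G\<^esub> r \<otimes>\<^bsub>G\<^esub> f) \<in> K"
      by (intro K.m_closed[OF \<open>r \<in> K\<close>] \<open>inv\<^bsub>G\<^esub> r \<otimes>\<^bsub>G\<^esub> f \<in> K\<close>)
    then show "f \<in> K"
      using r' f by (simp flip: m_assoc)
  qed
  then have "K = carrier G"
    using K.subset by blast
  then show ?thesis
    unfolding topologically_fin_gen_def K_def using S(2) \<open>finite R\<close> SR by blast
qed

text \<open>Modulo \<open>q\<close> the map \<open>\<phi>\<close> is a crossed homomorphism with
  respect to \<open>\<sigma>\<close>, and the zero set of a crossed homomorphism is a subgroup. For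
  \<open>\<sigma>\<close> constantly 1 this is the kernel of a homomorphism.\<close>

lemma subgroup_dvd:
  assumes R: "subgroup R G"
    and mult: "\<And>f g. f \<in> R \<Longrightarrow> g \<in> R \<Longrightarrow> [\<phi> (f \<otimes>\<^bsub>G\<^esub> g) = \<phi> f + \<sigma> f * \<phi> g] (mod q)"
    and one: "q dvd \<phi> \<one>\<^bsub>G\<^esub>"
  shows "subgroup {f \<in> R. q dvd (\<phi> f :: int)} G"
proof -
  interpret R: subgroup R G
    by (rule R)
  show ?thesis
  proof (rule subgroupI)
    show "{f \<in> R. q dvd \<phi> f} \<noteq> {}"
      using one R.one_closed by blast
  next
    fix f assume f: "f \<in> {f \<in> R. q dvd \<phi> f}"
    then have "[\<phi> \<one>\<^bsub>G\<^esub> = \<phi> (inv\<^bsub>G\<^esub> f) + \<sigma> (inv\<^bsub>G\<^esub> f) * \<phi> f] (mod q)"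
      using mult[of "inv\<^bsub>G\<^esub> f" f] by simp
    then have "q dvd \<phi> (inv\<^bsub>G\<^esub> f) + \<sigma> (inv\<^bsub>G\<^esub> f) * \<phi> f"
      using one cong_dvd_iff by blast
    then show "inv\<^bsub>G\<^esub> f \<in> {f \<in> R. q dvd \<phi> f}"
      using f by (auto simp: dvd_add_left_iff)
  next
    fix f g assume f: "f \<in> {f \<in> R. q dvd \<phi> f}" and g: "g \<in> {f \<in> R. q dvd \<phi> f}"
    then have "q dvd \<phi> (f \<otimes>\<^bsub>G\<^esub> g)"
      using mult[of f g] cong_dvd_iff by fastforce
    with f g show "f \<otimes>\<^bsub>G\<^esub> g \<in> {f \<in> R. q dvd \<phi> f}"
      by simp
  qed (use R.subset in auto)
qed

end

section \<open>Components of a graph\<close>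

text \<open>Connectedness is strong connectedness of the symmetrised graph, so walks may traverse
  arcs in both directions.\<close>

lemma arcs_ends_mk_symmetric:
  "arcs_ends (with_proj (mk_symmetric H)) = arcs_ends H \<union> (arcs_ends H)\<inverse>"
  by (auto simp: mk_symmetric_def arcs_ends_def arc_to_ends_def)

lemma connected_imp_constant:
  assumes conn: "Digraph_Component.connected H"
    and arc: "\<And>u v. (u, v) \<in> arcs_ends H \<Longrightarrow> \<tau> u = \<tau> v"
    and uv: "u \<in> verts H" "v \<in> verts H"
  shows "\<tau> u = \<tau> v"
proof -
  have "u \<rightarrow>\<^sup>*\<^bsub>with_proj (mk_symmetric H)\<^esub> v"
    using conn uv unfolding connected_def strongly_connected_def by (simp add: mk_symmetric_def)
  then have "(u, v) \<in> (arcs_ends H \<union> (arcs_ends H)\<inverse>)\<^sup>*"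
    unfolding reachable_def arcs_ends_mk_symmetric by (rule rtrancl_on_rtranclI)
  then show ?thesis
    by (induction rule: rtrancl_induct) (auto dest: arc)
qed

text \<open>The label \<open>\<tau>\<close> is constant along arcs, hence on connected subgraphs.
  Conversely, a common neighbour joins any two vertices with the same label by a walk of length two.
  So the components are exactly the subgraphs induced on the nonempty fibres of
  \<open>\<tau>\<close>.\<close>

lemma card_connected_components:
  assumes wf: "wf_digraph \<Gamma>"
    and arc: "\<And>u v. (u, v) \<in> arcs_ends \<Gamma> \<Longrightarrow> \<tau> u = \<tau> v"
    and common: "\<And>u v. u \<in> verts \<Gamma> \<Longrightarrow> v \<in> verts \<Gamma> \<Longrightarrow> \<tau> u = \<tau> v \<Longrightarrow>
      \<exists>w. (u, w) \<in> arcs_ends \<Gamma> \<and> (v, w) \<in> arcs_ends \<Gamma>"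
  shows "card (connected_components \<Gamma>) = card (\<tau> ` verts \<Gamma>)"
proof -
  interpret wf_digraph \<Gamma>
    by (rule wf)
  define comp where "comp i = induce_subgraph \<Gamma> {v \<in> verts \<Gamma>. \<tau> v = i}" for i
  have verts_comp: "verts (comp i) = {v \<in> verts \<Gamma>. \<tau> v = i}" for i
    by (simp add: comp_def)
  have sub_comp: "subgraph (comp i) \<Gamma>" for i
    unfolding comp_def by (intro subgraph_induce_subgraphI) auto
  have const: "\<tau> u = \<tau> v"
    if "Digraph_Component.connected H" "subgraph H \<Gamma>" "u \<in> verts H" "v \<in> verts H" for H u v
  proof (rule connected_imp_constant[OF that(1) _ that(3,4)])
    fix u v assume "(u, v) \<in> arcs_ends H"
    moreover have "arcs H \<subseteq> arcs \<Gamma>" "tail \<Gamma> = tail H" "head \<Gamma> = head H"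
      using that(2) by (auto simp: subgraph_def compatible_def)
    ultimately show "\<tau> u = \<tau> v"
      by (intro arc) (auto simp: arcs_ends_def arc_to_ends_def)
  qed
  have conn_comp: "Digraph_Component.connected (comp i)" if "i \<in> \<tau> ` verts \<Gamma>" for i
    unfolding connected_def
  proof (rule strongly_connectedI)
    show "verts (with_proj (mk_symmetric (comp i))) \<noteq> {}"
      using that by (auto simp: mk_symmetric_def verts_comp)
    fix u v
    assume "u \<in> verts (with_proj (mk_symmetric (comp i)))" "v \<in> verts (with_proj (mk_symmetric (comp i)))"
    then have u: "u \<in> verts \<Gamma>" "\<tau> u = i" and v: "v \<in> verts \<Gamma>" "\<tau> v = i"
      by (auto simp: mk_symmetric_def verts_comp)
    then obtain w where w: "(u, w) \<in> arcs_ends \<Gamma>" "(v, w) \<in> arcs_ends \<Gamma>"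
      using common by metis
    then have w': "w \<in> verts \<Gamma>" "\<tau> w = i"
      using u arc by auto
    have "(u, w) \<in> arcs_ends (comp i)" "(v, w) \<in> arcs_ends (comp i)"
      using w w' u v by (auto simp: comp_def induce_subgraph_def arcs_ends_def arc_to_ends_def)
    moreover have "u \<in> verts (comp i)" "v \<in> verts (comp i)" "w \<in> verts (comp i)"
      using u v w' by (auto simp: verts_comp)
    ultimately have "(u, w) \<in> rtrancl_on (verts (comp i)) (arcs_ends (comp i) \<union> (arcs_ends (comp i))\<inverse>)"
        "(w, v) \<in> rtrancl_on (verts (comp i)) (arcs_ends (comp i) \<union> (arcs_ends (comp i))\<inverse>)"
      by (auto intro: rtrancl_on_into_rtrancl_on[OF rtrancl_on_refl])
    then show "u \<rightarrow>\<^sup>*\<^bsub>with_proj (mk_symmetric (comp i))\<^esub> v"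
      unfolding reachable_def arcs_ends_mk_symmetric
      by (auto simp: mk_symmetric_def intro: rtrancl_on_trans)
  qed
  \<comment> \<open>A connected graph containing \<open>comp i\<close> stays inside the fibre, and
    since \<open>comp i\<close> is induced it gains no arcs either.\<close>
  have max_comp: "H = comp i"
    if H: "subgraph H \<Gamma>" "Digraph_Component.connected H" and sub: "subgraph (comp i) H"
      and i: "i \<in> \<tau> ` verts \<Gamma>" for H i
  proof -
    obtain v where v: "v \<in> verts (comp i)"
      using i by (auto simp: verts_comp)
    then have "v \<in> verts H" "\<tau> v = i"
      using sub by (auto simp: subgraph_def verts_comp)
    then have "verts H \<subseteq> verts (comp i)"
      using const[OF H(2,1) _ \<open>v \<in> verts H\<close>] subgraph_imp_subverts[OF H(1)]
      unfolding verts_comp by blast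
    moreover have "arcs H \<subseteq> arcs (comp i)"
    proof
      fix e assume e: "e \<in> arcs H"
      then have "tail H e \<in> verts H" "head H e \<in> verts H"
        using H(1) by (auto simp: subgraph_def wf_digraph_def)
      with e calculation H(1) show "e \<in> arcs (comp i)"
        by (auto simp: subgraph_def compatible_def comp_def induce_subgraph_def)
    qed
    ultimately show ?thesis
      using sub by (intro pre_digraph.equality) (auto simp: subgraph_def compatible_def)
  qed
  have "connected_components \<Gamma> = comp ` \<tau> ` verts \<Gamma>"
  proof (intro equalityI subsetI)
    fix H assume "H \<in> connected_components \<Gamma>"
    then have H: "subgraph H \<Gamma>" "Digraph_Component.connected H"
      and mx: "\<And>H'. subgraph H H' \<Longrightarrow> subgraph H' \<Gamma> \<Longrightarrow> Digraph_Component.connected H' \<Longrightarrow> H' = H"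
      by (auto simp: connected_components_def max_subgraph_def)
    obtain v where v: "v \<in> verts H"
      using H(2) by (auto simp: connected_def strongly_connected_def mk_symmetric_def)
    then have i: "\<tau> v \<in> \<tau> ` verts \<Gamma>"
      using H(1) by (auto simp: subgraph_def)
    have sub: "verts H \<subseteq> {u \<in> verts \<Gamma>. \<tau> u = \<tau> v}"
      using const[OF H(2,1) _ v] H(1) by (auto simp: subgraph_def)
    have "subgraph H (comp (\<tau> v))"
      unfolding subgraph_def
    proof (intro conjI)
      show "arcs H \<subseteq> arcs (comp (\<tau> v))"
      proof
        fix e assume e: "e \<in> arcs H"
        then have "tail H e \<in> verts H" "head H e \<in> verts H"
          using H(1) by (auto simp: subgraph_def wf_digraph_def)
        with e sub H(1) show "e \<in> arcs (comp (\<tau> v))"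
          by (auto simp: subgraph_def compatible_def comp_def induce_subgraph_def)
      qed
    qed (use H(1) sub sub_comp[of "\<tau> v"] in \<open>auto simp: subgraph_def compatible_def verts_comp\<close>)
    then have "H = comp (\<tau> v)"
      using mx sub_comp conn_comp[OF i] by metis
    with i show "H \<in> comp ` \<tau> ` verts \<Gamma>"
      by blast
  next
    fix H assume "H \<in> comp ` \<tau> ` verts \<Gamma>"
    then show "H \<in> connected_components \<Gamma>"
      unfolding connected_components_def max_subgraph_def
      using sub_comp conn_comp max_comp by blast
  qed
  \<comment> \<open>The fibres are nonempty, and any vertex of \<open>comp i\<close> determines
    \<open>i\<close>.\<close>
  moreover have "inj_on comp (\<tau> ` verts \<Gamma>)"
  proof (rule inj_onI)
    fix i j assume "i \<in> \<tau> ` verts \<Gamma>" "j \<in> \<tau> ` verts \<Gamma>" "comp i = comp j"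
    then show "i = j"
      using verts_comp[of i] verts_comp[of j] by auto
  qed
  ultimately show ?thesis
    by (simp add: card_image)
qed

section \<open>Parities on transversals of the blocks\<close>

text \<open>Such a set may contain both points of a block. The three possible intersections with a
  block correspond to the three nonzero linear forms on the two bits over the field with two
  elements.\<close>

definition transversals :: "nat \<Rightarrow> nat set set" where
  "transversals t = {A. A \<subseteq> {..<2 * t} \<and> (\<forall>i<t. 2 * i \<in> A \<or> 2 * i + 1 \<in> A)}"

text \<open>The last condition is a determinant mod 2: the bits of \<open>x\<close> and
  \<open>y\<close> in block \<open>i\<close> are linearly independent, while all bits in other
  blocks are zero mod 2.\<close>

definition same_block :: "nat \<Rightarrow> (nat \<Rightarrow> nat) \<Rightarrow> (nat \<Rightarrow> nat) \<Rightarrow> nat \<Rightarrow> bool" where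
  "same_block t x y i \<longleftrightarrow> i < t \<and> (\<forall>j<2 * t. j div 2 \<noteq> i \<longrightarrow> even (x j) \<and> even (y j)) \<and>
     odd (x (2 * i) * y (2 * i + 1) + x (2 * i + 1) * y (2 * i))"

definition parity_pairs :: "nat \<Rightarrow> (nat \<Rightarrow> nat) \<Rightarrow> (nat \<Rightarrow> nat) \<Rightarrow> (bool \<times> bool) set" where
  "parity_pairs t x y = (\<lambda>A. (odd (sum x A), odd (sum y A))) ` transversals t"

lemma transversals_Suc:
  "transversals (Suc t) = (\<lambda>(A, B). A \<union> B) `
     (transversals t \<times> {{2 * t}, {2 * t + 1}, {2 * t, 2 * t + 1}})"
proof (intro equalityI subsetI)
  fix C assume C: "C \<in> transversals (Suc t)"
  let ?A = "C \<inter> {..<2 * t}" and ?B = "C \<inter> {2 * t, 2 * t + 1}"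
  have "C = ?A \<union> ?B"
    using C by (auto simp: transversals_def less_Suc_eq)
  moreover have "?A \<in> transversals t"
    using C by (auto simp: transversals_def)
  moreover have "?B \<in> {{2 * t}, {2 * t + 1}, {2 * t, 2 * t + 1}}"
  proof -
    have "2 * t \<in> C \<or> 2 * t + 1 \<in> C"
      using C by (auto simp: transversals_def)
    then show ?thesis
      by auto
  qed
  ultimately show "C \<in> (\<lambda>(A, B). A \<union> B) ` (transversals t \<times> {{2 * t}, {2 * t + 1}, {2 * t, 2 * t + 1}})"
    by blast
qed (auto simp: transversals_def less_Suc_eq)

lemma parity_pairs_0: "parity_pairs 0 x y = {(False, False)}"
  by (auto simp: parity_pairs_def transversals_def)

text \<open>Sums over \<open>A\<close> split into the old blocks and the last one, so the new set is
  a sumset in the four-group, with inequality of booleans as addition.\<close>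

lemma parity_pairs_Suc:
  "parity_pairs (Suc t) x y =
    (\<lambda>((p, q), (r, s)). (p \<noteq> r, q \<noteq> s)) ` (parity_pairs t x y \<times>
      {(odd (x (2 * t)), odd (y (2 * t))), (odd (x (2 * t + 1)), odd (y (2 * t + 1))),
       (odd (x (2 * t)) \<noteq> odd (x (2 * t + 1)), odd (y (2 * t)) \<noteq> odd (y (2 * t + 1)))})"
proof -
  have *: "sum f (A \<union> B) = sum f A + sum f B"
    if "A \<in> transversals t" "B \<in> {{2 * t}, {2 * t + 1}, {2 * t, 2 * t + 1}}" for f :: "nat \<Rightarrow> nat" and A B
  proof (rule sum.union_disjoint)
    show "finite A" "A \<inter> B = {}"
      using that by (auto simp: transversals_def intro: finite_subset)
    show "finite B"
      using that by auto
  qed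
  have "parity_pairs (Suc t) x y = (\<lambda>(A, B). (odd (sum x A + sum x B), odd (sum y A + sum y B))) `
     (transversals t \<times> {{2 * t}, {2 * t + 1}, {2 * t, 2 * t + 1}})"
    unfolding parity_pairs_def transversals_Suc image_image
  proof (rule image_cong[OF refl])
    fix z assume "z \<in> transversals t \<times> {{2 * t}, {2 * t + 1}, {2 * t, 2 * t + 1}}"
    then obtain A B where "z = (A, B)" "A \<in> transversals t"
        "B \<in> {{2 * t}, {2 * t + 1}, {2 * t, 2 * t + 1}}"
      by blast
    then show "(odd (sum x (case z of (A, B) \<Rightarrow> A \<union> B)), odd (sum y (case z of (A, B) \<Rightarrow> A \<union> B))) =
        (case z of (A, B) \<Rightarrow> (odd (sum x A + sum x B), odd (sum y A + sum y B)))"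
      by (simp only: split *)
  qed
  also have "\<dots> = (\<lambda>((p, q), (r, s)). (p \<noteq> r, q \<noteq> s)) ` (parity_pairs t x y \<times>
      (\<lambda>B. (odd (sum x B), odd (sum y B))) ` {{2 * t}, {2 * t + 1}, {2 * t, 2 * t + 1}})"
    unfolding parity_pairs_def image_paired_Times[symmetric] image_image
    by (simp add: case_prod_beta)
  finally show ?thesis
    by simp
qed

text \<open>Every element of the four-group is its own inverse, so membership in a sumset becomes a
  condition on membership in \<open>P\<close>. This makes the induction below propositional.\<close>

lemma xor_image_iff:
  "(p, q) \<in> (\<lambda>((p, q), (r, s)). (p \<noteq> r, q \<noteq> s)) ` (P \<times> S) \<longleftrightarrow>
    (\<exists>r s. (r, s) \<in> S \<and> (p \<noteq> r, q \<noteq> s) \<in> P)" (is "_ \<in> ?f ` _ \<longleftrightarrow> ?R")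
proof
  assume "(p, q) \<in> ?f ` (P \<times> S)"
  then obtain p' q' r s where *: "(p', q') \<in> P" "(r, s) \<in> S" "p = (p' \<noteq> r)" "q = (q' \<noteq> s)"
    by auto
  then have "(p \<noteq> r) = p'" "(q \<noteq> s) = q'"
    by auto
  with *(1) have "(p \<noteq> r, q \<noteq> s) \<in> P"
    by (simp only:)
  with *(2) show ?R
    by blast
next
  assume ?R
  then obtain r s where *: "(r, s) \<in> S" "(p \<noteq> r, q \<noteq> s) \<in> P"
    by blast
  have "(p, q) = ?f ((p \<noteq> r, q \<noteq> s), (r, s))"
    by auto
  with * show "(p, q) \<in> ?f ` (P \<times> S)"
    by (intro image_eqI[of _ _ "((p \<noteq> r, q \<noteq> s), (r, s))"]) auto
qed

lemma ex_pair_3: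
  "(\<exists>r s. (r, s) \<in> {(a, b), (a', b'), (a'', b'')} \<and> R r s) \<longleftrightarrow> R a b \<or> R a' b' \<or> R a'' b''"
  by auto

text \<open>A strengthened induction invariant. One block contributes {0}, or {0, z} with z nonzero,
  or all nonzero vectors, as the bits of \<open>x\<close> and \<open>y\<close> there have rank 0, 1
  or 2. Adding such sets, zero is missed only if one block has rank 2 and all others have rank
  0.\<close>

lemma parity_pairs_cases:
  "(\<forall>j<2 * t. even (x j) \<and> even (y j)) \<and> parity_pairs t x y = {(False, False)} \<or>
   (False, False) \<in> parity_pairs t x y \<and> parity_pairs t x y \<noteq> {(False, False)} \<or>
   (\<exists>i. same_block t x y i) \<and> parity_pairs t x y = - {(False, False)}"
proof (induction t)
  case 0
  then show ?case
    by (simp add: parity_pairs_0)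
next
  case (Suc t)
  define P where "P = parity_pairs t x y"
  define a a' b b' where "a = odd (x (2 * t))" and "a' = odd (x (2 * t + 1))"
    and "b = odd (y (2 * t))" and "b' = odd (y (2 * t + 1))"
  define Q where "Q = parity_pairs (Suc t) x y"
  have Q: "(p, q) \<in> Q \<longleftrightarrow> (p \<noteq> a, q \<noteq> b) \<in> P \<or> (p \<noteq> a', q \<noteq> b') \<in> P \<or>
      (p \<noteq> (a \<noteq> a'), q \<noteq> (b \<noteq> b')) \<in> P" for p q
    unfolding Q_def parity_pairs_Suc P_def[symmetric] a_def[symmetric] b_def[symmetric]
      a'_def[symmetric] b'_def[symmetric]
    xor_image_iff ex_pair_3 by (rule refl)
  \<comment> \<open>Sets of boolean pairs are compared at their four points, so the induction step
    becomes a finite check over \<open>a\<close>, \<open>a'\<close>, \<open>b\<close>,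
    \<open>b'\<close>.\<close>
  have eq: "R = R' \<longleftrightarrow> (\<forall>p q. (p, q) \<in> R \<longleftrightarrow> (p, q) \<in> R')" for R R' :: "(bool \<times> bool) set"
    by auto
  have zero: "(\<forall>j<2 * Suc t. even (x j) \<and> even (y j)) \<longleftrightarrow>
      (\<forall>j<2 * t. even (x j) \<and> even (y j)) \<and> \<not> a \<and> \<not> a' \<and> \<not> b \<and> \<not> b'"
    by (auto simp: a_def b_def a'_def b'_def less_Suc_eq)
  have old: "same_block (Suc t) x y i"
    if "same_block t x y i" "\<not> a" "\<not> a'" "\<not> b" "\<not> b'" for i
    using that by (auto simp: same_block_def a_def b_def a'_def b'_def less_Suc_eq)
  have new: "same_block (Suc t) x y t"
    if "\<forall>j<2 * t. even (x j) \<and> even (y j)" "(a \<and> b') \<noteq> (a' \<and> b)"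
    using that by (auto simp: same_block_def a_def b_def a'_def b'_def less_Suc_eq)
  from Suc show ?case
    unfolding zero P_def[symmetric] Q_def[symmetric] eq Q all_bool_eq
    using old new
    by (cases a; cases a'; cases b; cases b') auto
qed

lemma exists_same_block:
  assumes "\<And>A. A \<in> transversals t \<Longrightarrow> odd (sum x A) \<or> odd (sum y A)"
  shows "\<exists>i. same_block t x y i"
proof -
  have "(False, False) \<notin> parity_pairs t x y"
    using assms by (auto simp: parity_pairs_def)
  then show ?thesis
    using parity_pairs_cases[of t x y] by auto
qed

section \<open>Pairs generating open subgroups\<close>

text \<open>Openness controls only almost all \<open>n\<close>, so each character has to recur for
  arbitrarily large \<open>n\<close>. Distinct primes allow the blocks to be separated by Chinese
  remaindering; primes from 5 on make 2 and 4 invertible and leave 1, 2, 3 distinct and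
  nonzero.\<close>

locale block_product =
  fixes t :: nat and p :: "nat \<Rightarrow> nat" and e :: "nat \<Rightarrow> nat set"
  assumes prime_p: "\<And>n. Factorial_Ring.prime (p n)"
    and p_ge_5: "\<And>n. 5 \<le> p n"
    and inj_p: "inj p"
    and e_transversal: "\<And>n. e n \<in> transversals t"
    and e_recurrent: "\<And>A N. A \<in> transversals t \<Longrightarrow> \<exists>n\<ge>N. e n = A"
begin

text \<open>Coordinates below \<open>2 * t\<close> are the bits, with block \<open>i\<close> at \<open>2 * i\<close> and \<open>2 * i + 1\<close>; they are followed
  by the three coordinates of each prime in turn.\<close>

definition modulus :: "nat \<Rightarrow> nat" where
  "modulus j = (if j < 2 * t then 2 else p ((j - 2 * t) div 3))"

definition twisting :: "nat \<Rightarrow> nat set" where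
  "twisting j = (if 2 * t \<le> j \<and> (j - 2 * t) mod 3 = 2 then e ((j - 2 * t) div 3) else {})"

sublocale twisted_digits modulus twisting "2 * t"
proof
  show "0 < modulus j" for j
    using p_ge_5[of "(j - 2 * t) div 3"] by (simp add: modulus_def)
  show "twisting j \<subseteq> {..<2 * t}" for j
    using e_transversal[of "(j - 2 * t) div 3"] by (simp add: twisting_def transversals_def)
qed (auto simp: modulus_def twisting_def)

definition U :: "nat \<Rightarrow> nat" where "U n = 2 * t + 3 * n"
definition V :: "nat \<Rightarrow> nat" where "V n = 2 * t + 3 * n + 1"
definition W :: "nat \<Rightarrow> nat" where "W n = 2 * t + 3 * n + 2"

lemma three_div_mod [simp]:
  "Suc (3 * n) div 3 = n" "Suc (Suc (3 * n)) div 3 = n"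
  "Suc (3 * n) mod 3 = 1" "Suc (Suc (3 * n)) mod 3 = 2"
  by presburger+

lemma modulus_UVW [simp]: "modulus (U n) = p n" "modulus (V n) = p n" "modulus (W n) = p n"
  by (auto simp: modulus_def U_def V_def W_def)

lemma twisting_UVW [simp]: "twisting (U n) = {}" "twisting (V n) = {}" "twisting (W n) = e n"
  by (auto simp: twisting_def U_def V_def W_def)

lemma coord_cases:
  obtains "j < 2 * t" | n where "j = U n" | n where "j = V n" | n where "j = W n"
proof -
  have "j = 2 * t + 3 * ((j - 2 * t) div 3) + (j - 2 * t) mod 3" if "\<not> j < 2 * t"
    using that by simp
  moreover have "(j - 2 * t) mod 3 = 0 \<or> (j - 2 * t) mod 3 = 1 \<or> (j - 2 * t) mod 3 = 2"
    by linarith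
  ultimately show thesis
    using that by (metis U_def V_def W_def add.right_neutral)
qed

lemma UVW_ge: "U n \<ge> n" "V n \<ge> n" "W n \<ge> n" "2 * t \<le> U n" "2 * t \<le> V n" "2 * t \<le> W n"
  by (auto simp: U_def V_def W_def)

lemma UVW_eq [simp]:
  "U n = U k \<longleftrightarrow> n = k" "V n = V k \<longleftrightarrow> n = k" "W n = W k \<longleftrightarrow> n = k"
  "U n \<noteq> V k" "V n \<noteq> U k" "U n \<noteq> W k" "W n \<noteq> U k" "V n \<noteq> W k" "W n \<noteq> V k"
  unfolding U_def V_def W_def by presburger+

abbreviation u :: "nat \<Rightarrow> (nat \<Rightarrow> nat) \<Rightarrow> int" where "u n x \<equiv> int (x (U n))"
abbreviation v :: "nat \<Rightarrow> (nat \<Rightarrow> nat) \<Rightarrow> int" where "v n x \<equiv> int (x (V n))"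
abbreviation w :: "nat \<Rightarrow> (nat \<Rightarrow> nat) \<Rightarrow> int" where "w n x \<equiv> int (x (W n))"
abbreviation P :: "nat \<Rightarrow> int" where "P n \<equiv> int (p n)"

lemma u_mult: "[u n (x \<otimes>\<^bsub>G\<^esub> y) = u n x + u n y] (mod P n)"
  by (simp add: int_mult_apply cong_def)

lemma v_mult: "[v n (x \<otimes>\<^bsub>G\<^esub> y) = v n x + v n y] (mod P n)"
  by (simp add: int_mult_apply cong_def)

lemma w_mult: "[w n (x \<otimes>\<^bsub>G\<^esub> y) = w n x + twist (e n) x * w n y] (mod P n)"
  by (simp add: int_mult_apply cong_def)

lemma e_subset: "e n \<subseteq> {..<2 * t}"
  using e_transversal[of n] by (simp add: transversals_def)

lemma prime_P: "Factorial_Ring.prime (P n)"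
  using prime_p by simp

lemma not_P_dvd_small: "0 < k \<Longrightarrow> k < 5 \<Longrightarrow> \<not> P n dvd k"
  using p_ge_5[of n] zdvd_imp_le[of "P n" k] by linarith

lemma twist_e_untwisted: "f \<in> untwisted_part \<Longrightarrow> twist (e n) f = 1"
  using twist_untwisted[of f "W n"] by simp

section \<open>Invariants of a pair and necessary conditions for openness\<close>

definition det :: "nat \<Rightarrow> (nat \<Rightarrow> nat) \<Rightarrow> (nat \<Rightarrow> nat) \<Rightarrow> int" where
  "det n x y = u n x * v n y - v n x * u n y"

text \<open>The \<open>w\<close>-coordinate of the commutator of \<open>x\<close> and \<open>y\<close>.\<close>

definition comm :: "nat \<Rightarrow> (nat \<Rightarrow> nat) \<Rightarrow> (nat \<Rightarrow> nat) \<Rightarrow> int" where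
  "comm n x y = (1 - twist (e n) y) * w n x - (1 - twist (e n) x) * w n y"

definition unit :: "nat \<Rightarrow> nat \<Rightarrow> nat" where
  "unit j = (\<lambda>i. if i = j then 1 else 0)"

lemma unit_carrier: "unit j \<in> carrier G"
proof -
  have "1 < modulus i" for i
    using p_ge_5[of "(i - 2 * t) div 3"] by (simp add: modulus_def)
  then show ?thesis
    using pos by (auto simp: unit_def carrier_iff)
qed

lemma twist_unit: "2 * t \<le> j \<Longrightarrow> twist (e n) (unit j) = 1"
  using e_subset[of n] by (subst twist_cong[where g = "\<lambda>_. 0"]) (auto simp: unit_def)

lemma subgroup_kernel_twist: "A \<subseteq> {..<2 * t} \<Longrightarrow> subgroup {f \<in> carrier G. twist A f = 1} G"
  by (rule subgroup.intro) (auto simp: twist_inv twist_mult mult_carrier one_carrier, simp add: one_eq)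

text \<open>Each failure puts \<open>x\<close> and \<open>y\<close> into a clopen subgroup that omits one of the unit vectors at \<open>n\<close>:
  a linear condition on \<open>u, v\<close>, or on \<open>u, v, w\<close> (with the cross product as normal vector) within the
  kernel of the character, or a coboundary condition on \<open>w\<close>.\<close>

lemma open_imp:
  assumes xy: "x \<in> carrier G" "y \<in> carrier G" and op: "openin T (closed_generate G T {x, y})"
  shows "\<exists>N. \<forall>n\<ge>N. \<not> P n dvd det n x y \<and> \<not> (twist (e n) x = 1 \<and> twist (e n) y = 1) \<and>
      (twist (e n) x = 1 \<longrightarrow> \<not> P n dvd w n x)"
proof -
  obtain N where N: "\<And>g. g \<in> carrier G \<Longrightarrow> \<forall>j<N. g j = 0 \<Longrightarrow> g \<in> closed_generate G T {x, y}"
    using op xy openin_closed_generate_iff[of "{x, y}"] by auto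
  have "\<not> P n dvd det n x y \<and> \<not> (twist (e n) x = 1 \<and> twist (e n) y = 1) \<and>
      (twist (e n) x = 1 \<longrightarrow> \<not> P n dvd w n x)" if n: "n \<ge> N" for n
  proof -
    \<comment> \<open>For \<open>n\<close> at least \<open>N\<close> these vectors vanish below
      \<open>N\<close>, so the open subgroup contains them.\<close>
    have units: "unit (U n) \<in> closed_generate G T {x, y}" "unit (V n) \<in> closed_generate G T {x, y}"
        "unit (W n) \<in> closed_generate G T {x, y}"
      using n UVW_ge[of n] by (auto intro!: N[OF unit_carrier]) (auto simp: unit_def)
    \<comment> \<open>The test used three times below: a subgroup that contains \<open>x\<close> and
      \<open>y\<close>, and is decided by the three digits at \<open>n\<close> and the character,
      must contain all unit vectors at \<open>n\<close>.\<close>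
    have unit_in: "unit (U n) \<in> Q" "unit (V n) \<in> Q" "unit (W n) \<in> Q"
      if Q: "subgroup Q G" "x \<in> Q" "y \<in> Q"
        and clopen: "\<And>f g. f \<in> Q \<Longrightarrow> g \<in> carrier G \<Longrightarrow> f (U n) = g (U n) \<Longrightarrow> f (V n) = g (V n) \<Longrightarrow>
          f (W n) = g (W n) \<Longrightarrow> twist (e n) f = twist (e n) g \<Longrightarrow> g \<in> Q" for Q
    proof -
      have "closed_generate G T {x, y} \<subseteq> Q"
      proof (rule closed_generate_subset[OF Q(1)])
        \<comment> \<open>The segment up to and including \<open>W n\<close> covers the bits as well
          as the three digits at \<open>n\<close>.\<close>
        fix f g assume *: "f \<in> Q" "g \<in> carrier G" "\<forall>j<Suc (W n). f j = g j"
        moreover have "twist (e n) f = twist (e n) g"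
          using * e_subset[of n] UVW_ge[of n] by (intro twist_cong) auto
        moreover have "U n < Suc (W n)" "V n < Suc (W n)" "W n < Suc (W n)"
          by (auto simp: U_def V_def W_def)
        ultimately show "g \<in> Q"
          by (intro clopen[of f g]) auto
      qed (use Q in auto)
      then show "unit (U n) \<in> Q" "unit (V n) \<in> Q" "unit (W n) \<in> Q"
        using units by auto
    qed
    have D: "\<not> P n dvd det n x y"
    proof
      assume dv: "P n dvd det n x y"
      \<comment> \<open>A vanishing determinant mod p gives a nonzero linear form in u, v that kills
        \<open>x\<close> and \<open>y\<close>: the one orthogonal to \<open>x\<close>, or to
        \<open>y\<close> if \<open>x\<close> is zero there, or any form if both are zero.\<close>
      have "\<exists>a b. (\<not> P n dvd a \<or> \<not> P n dvd b) \<and> P n dvd a * u n x + b * v n x \<and>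
          P n dvd a * u n y + b * v n y"
      proof -
        consider "\<not> P n dvd u n x \<or> \<not> P n dvd v n x"
          | "P n dvd u n x" "P n dvd v n x" "\<not> P n dvd u n y \<or> \<not> P n dvd v n y"
          | "P n dvd u n x" "P n dvd v n x" "P n dvd u n y" "P n dvd v n y"
          by blast
        then show ?thesis
        proof cases
          case 1
          with dv show ?thesis
            by (intro exI[of _ "- v n x"] exI[of _ "u n x"]) (auto simp: det_def algebra_simps)
        next
          case 2
          then show ?thesis
            by (intro exI[of _ "- v n y"] exI[of _ "u n y"]) (auto simp: algebra_simps)
        next
          case 3
          then show ?thesis
            using not_P_dvd_small[of 1 n] by (intro exI[of _ 1] exI[of _ 0]) auto
        qed
      qed
      then obtain a b where ab: "\<not> P n dvd a \<or> \<not> P n dvd b" "P n dvd a * u n x + b * v n x"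
          "P n dvd a * u n y + b * v n y"
        by blast
      let ?Q = "{f \<in> carrier G. P n dvd a * u n f + b * v n f}"
      have "subgroup ?Q G"
      proof (rule subgroup_dvd[where \<sigma> = "\<lambda>_. 1"])
        fix f g
        have "[a * u n (f \<otimes>\<^bsub>G\<^esub> g) + b * v n (f \<otimes>\<^bsub>G\<^esub> g) =
            a * (u n f + u n g) + b * (v n f + v n g)] (mod P n)"
          by (intro cong_add cong_mult cong_refl u_mult v_mult)
        then show "[a * u n (f \<otimes>\<^bsub>G\<^esub> g) + b * v n (f \<otimes>\<^bsub>G\<^esub> g) =
            a * u n f + b * v n f + 1 * (a * u n g + b * v n g)] (mod P n)"
          by (simp add: algebra_simps)
      qed (auto simp: subgroup_self one_eq)
      then have "unit (U n) \<in> ?Q" "unit (V n) \<in> ?Q"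
        by (rule unit_in; use xy ab in auto)+
      then show False
        using ab(1) by (auto simp: unit_def)
    qed
    moreover have E: "\<not> (twist (e n) x = 1 \<and> twist (e n) y = 1)"
    proof
      assume tw: "twist (e n) x = 1 \<and> twist (e n) y = 1"
      \<comment> \<open>With \<open>det n x y\<close> these are the coordinates of the cross
        product. It is orthogonal to \<open>x\<close> and \<open>y\<close>, but its last coordinate
        is nonzero mod p by \<open>D\<close>, which excludes \<open>unit (W n)\<close>.\<close>
      let ?a = "v n x * w n y - w n x * v n y" and ?b = "w n x * u n y - u n x * w n y"
      let ?Q = "{f \<in> {f \<in> carrier G. twist (e n) f = 1}.
          P n dvd ?a * u n f + ?b * v n f + det n x y * w n f}"
      have "subgroup ?Q G"
      proof (rule subgroup_dvd[where \<sigma> = "\<lambda>_. 1"])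
        fix f g assume "f \<in> {f \<in> carrier G. twist (e n) f = 1}"
        then have tf: "twist (e n) f = 1"
          by simp
        have "[?a * u n (f \<otimes>\<^bsub>G\<^esub> g) + ?b * v n (f \<otimes>\<^bsub>G\<^esub> g) + det n x y * w n (f \<otimes>\<^bsub>G\<^esub> g) =
            ?a * (u n f + u n g) + ?b * (v n f + v n g) + det n x y * (w n f + twist (e n) f * w n g)] (mod P n)"
          by (intro cong_add cong_mult cong_refl u_mult v_mult w_mult)
        also have "?a * (u n f + u n g) + ?b * (v n f + v n g) + det n x y * (w n f + twist (e n) f * w n g) =
            ?a * u n f + ?b * v n f + det n x y * w n f +
            1 * (?a * u n g + ?b * v n g + det n x y * w n g)"
          unfolding tf by (simp add: algebra_simps)
        finally show "[?a * u n (f \<otimes>\<^bsub>G\<^esub> g) + ?b * v n (f \<otimes>\<^bsub>G\<^esub> g) + det n x y * w n (f \<otimes>\<^bsub>G\<^esub> g) =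
            ?a * u n f + ?b * v n f + det n x y * w n f +
            1 * (?a * u n g + ?b * v n g + det n x y * w n g)] (mod P n)" .
      qed (auto simp: subgroup_kernel_twist e_subset one_eq)
      moreover have "?a * u n x + ?b * v n x + det n x y * w n x = 0"
          "?a * u n y + ?b * v n y + det n x y * w n y = 0"
        unfolding det_def by (simp_all add: algebra_simps)
      then have "x \<in> ?Q" "y \<in> ?Q"
        using xy tw by auto
      ultimately have "unit (W n) \<in> ?Q"
        by (intro unit_in) auto
      then show False
        using D by (simp add: unit_def)
    qed
    moreover have "\<not> P n dvd w n x" if tx: "twist (e n) x = 1"
    proof
      assume dv: "P n dvd w n x"
      \<comment> \<open>Twice the cocycle w minus a coboundary chosen to vanish at \<open>y\<close>,
        where the sign is -1. It also vanishes mod p at \<open>x\<close>, where the sign is 1 and p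
        divides w, but has the value 2 at \<open>unit (W n)\<close>.\<close>
      let ?\<phi> = "\<lambda>f. 2 * w n f - (1 - twist (e n) f) * w n y"
      let ?Q = "{f \<in> carrier G. P n dvd ?\<phi> f}"
      have ty: "twist (e n) y = -1"
        using E tx twist_cases[of "e n" y] by auto
      have "subgroup ?Q G"
      proof (rule subgroup_dvd[where \<sigma> = "twist (e n)"])
        fix f g
        have "[2 * w n (f \<otimes>\<^bsub>G\<^esub> g) - (1 - twist (e n) (f \<otimes>\<^bsub>G\<^esub> g)) * w n y =
           2 * (w n f + twist (e n) f * w n g) - (1 - twist (e n) (f \<otimes>\<^bsub>G\<^esub> g)) * w n y] (mod P n)"
          by (intro cong_diff cong_mult cong_refl w_mult)
        then show "[?\<phi> (f \<otimes>\<^bsub>G\<^esub> g) = ?\<phi> f + twist (e n) f * ?\<phi> g] (mod P n)"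
          by (simp add: twist_mult[OF e_subset] algebra_simps)
      qed (auto simp: subgroup_self one_eq)
      moreover have "x \<in> ?Q" "y \<in> ?Q"
        using xy dv tx ty by auto
      ultimately have "unit (W n) \<in> ?Q"
        by (intro unit_in) auto
      then have "P n dvd 2"
        using UVW_ge[of n] by (simp add: twist_unit) (simp add: unit_def)
      then show False
        using not_P_dvd_small[of 2 n] by simp
    qed
    ultimately show ?thesis
      by blast
  qed
  then show ?thesis
    by blast
qed

end

section \<open>Sufficient condition for openness: reaching the blocks one at a time\<close>

lemma (in twisted_digits) untwisted_pow:
  assumes f: "f \<in> untwisted_part"
  shows "f [^]\<^bsub>G\<^esub> (k :: nat) \<in> untwisted_part \<and>
    [int ((f [^]\<^bsub>G\<^esub> k) j) = int k * int (f j)] (mod int (m j))"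
proof (induction k)
  case 0
  then show ?case
    using subgroup.one_closed[OF subgroup_untwisted] by (simp add: one_eq)
next
  case (Suc k)
  then have "[int ((f [^]\<^bsub>G\<^esub> k) j) + int (f j) = int k * int (f j) + int (f j)] (mod int (m j))"
    by (intro cong_add cong_refl) auto
  with Suc show ?case
    using f by (simp add: mult_untwisted int_mult_apply twist_untwisted cong_def algebra_simps)
qed

text \<open>Cramer's rule, with \<open>D\<close> an inverse of the determinant mod
  \<open>q\<close>.\<close>

lemma solve_2x2_cong:
  fixes q :: int
  assumes "Factorial_Ring.prime q" "\<not> q dvd a * d - b * c"
  obtains i j where "[i * a + j * c = \<alpha>] (mod q)" "[i * b + j * d = \<beta>] (mod q)"
proof -
  have "coprime (a * d - b * c) q"
    using assms prime_imp_coprime coprime_commute by blast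
  then obtain D where D: "[(a * d - b * c) * D = 1] (mod q)"
    using cong_solve_coprime_int by blast
  show thesis
  proof
    have "[\<alpha> * ((a * d - b * c) * D) = \<alpha> * 1] (mod q)"
      using D by (rule cong_scalar_left)
    then show "[D * (\<alpha> * d - \<beta> * c) * a + D * (\<beta> * a - \<alpha> * b) * c = \<alpha>] (mod q)"
      by (simp add: algebra_simps)
    have "[\<beta> * ((a * d - b * c) * D) = \<beta> * 1] (mod q)"
      using D by (rule cong_scalar_left)
    then show "[D * (\<alpha> * d - \<beta> * c) * b + D * (\<beta> * a - \<alpha> * b) * d = \<beta>] (mod q)"
      by (simp add: algebra_simps)
  qed
qed

lemma solve_cong:
  fixes q :: int
  assumes "Factorial_Ring.prime q" "\<not> q dvd a"
  obtains i where "[i * a = \<alpha>] (mod q)"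
proof -
  have "coprime a q"
    using assms prime_imp_coprime coprime_commute by blast
  then obtain D where "[a * D = 1] (mod q)"
    using cong_solve_coprime_int by blast
  then have "[\<alpha> * (a * D) = \<alpha> * 1] (mod q)"
    by (rule cong_scalar_left)
  then show thesis
    by (intro that[of "\<alpha> * D"]) (simp add: algebra_simps)
qed

context block_product
begin

definition vanishes :: "nat \<Rightarrow> (nat \<Rightarrow> nat) \<Rightarrow> bool" where
  "vanishes n f \<longleftrightarrow> f (U n) = 0 \<and> f (V n) = 0 \<and> f (W n) = 0"

definition agrees :: "nat \<Rightarrow> (nat \<Rightarrow> nat) \<Rightarrow> (nat \<Rightarrow> nat) \<Rightarrow> bool" where
  "agrees n f g \<longleftrightarrow> f (U n) = g (U n) \<and> f (V n) = g (V n) \<and> f (W n) = g (W n)"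

lemma untwisted_uvw_mult:
  assumes "f \<in> untwisted_part"
  shows "[u n (f \<otimes>\<^bsub>G\<^esub> g) = u n f + u n g] (mod P n)"
    "[v n (f \<otimes>\<^bsub>G\<^esub> g) = v n f + v n g] (mod P n)"
    "[w n (f \<otimes>\<^bsub>G\<^esub> g) = w n f + w n g] (mod P n)"
  using u_mult[of f g n] v_mult[of f g n] w_mult[of f g n] twist_e_untwisted[OF assms] by simp_all

lemma vanishes_mult:
  assumes "f \<in> untwisted_part" "vanishes n f" "vanishes n g"
  shows "vanishes n (f \<otimes>\<^bsub>G\<^esub> g)"
  using assms by (simp add: vanishes_def mult_apply)

lemma agrees_mult_vanishes:
  assumes "f \<in> untwisted_part" "f \<in> carrier G" "g \<in> carrier G"
  shows "vanishes n g \<Longrightarrow> agrees n (f \<otimes>\<^bsub>G\<^esub> g) f" "vanishes n f \<Longrightarrow> agrees n (f \<otimes>\<^bsub>G\<^esub> g) g"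
  using assms carrierD[of f "U n"] carrierD[of f "V n"] carrierD[of f "W n"]
    carrierD[of g "U n"] carrierD[of g "V n"] carrierD[of g "W n"]
  by (auto simp: vanishes_def agrees_def mult_apply twist_e_untwisted)

text \<open>Chinese remaindering: the power of \<open>f\<close> by an exponent divisible by the
  other primes below \<open>M\<close> and congruent to \<open>a\<close> mod \<open>p n\<close> kills
  the other blocks below \<open>M\<close> and scales block \<open>n\<close> by
  \<open>a\<close>.\<close>

lemma isolate:
  assumes H: "subgroup H G" and f: "f \<in> H" "f \<in> untwisted_part"
  shows "\<exists>h\<in>H \<inter> untwisted_part. (\<forall>k<M. k \<noteq> n \<longrightarrow> vanishes k h) \<and>
    [u n h = a * u n f] (mod P n) \<and> [v n h = a * v n f] (mod P n) \<and> [w n h = a * w n f] (mod P n)"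
proof -
  define q where "q = (\<Prod>k\<in>{..<M} - {n}. p k)"
  have "Rings.coprime (p k) (p n)" if "k \<noteq> n" for k
    using that prime_p inj_p by (intro primes_coprime) (auto dest: injD)
  then have "Rings.coprime q (p n)"
    unfolding q_def by (intro prod_coprime_left) auto
  then have "\<not> P n dvd int q"
    using prime_p[of n] by (metis coprime_absorb_right int_dvd_int_iff not_prime_unit)
  then obtain i where i: "[i * int q = a] (mod P n)"
    using solve_cong[OF prime_P] by blast
  define K where "K = nat (i mod P n) * q"
  have "int K = (i mod P n) * int q"
    using prime_gt_0_nat[OF prime_p[of n]] by (simp add: K_def)
  moreover have "[(i mod P n) * int q = i * int q] (mod P n)"
    by (simp add: cong_def mod_simps)
  ultimately have K: "[int K = a] (mod P n)"
    using i cong_trans by metis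
  define h where "h = f [^]\<^bsub>G\<^esub> K"
  have h: "h \<in> untwisted_part" "[int (h j) = int K * int (f j)] (mod int (modulus j))" for j
    unfolding h_def using untwisted_pow[OF f(2)] by auto
  have hc: "h \<in> carrier G"
    using h(1) by (simp add: untwisted_part_def)
  have "h \<in> H"
    unfolding h_def using f(1) H by (induction K) (auto simp: subgroup.one_closed subgroup.m_closed)
  show ?thesis
  proof (intro bexI[of _ h] conjI allI impI)
    show "h \<in> H \<inter> untwisted_part"
      using h \<open>h \<in> H\<close> by blast
    fix k assume "k < M" "k \<noteq> n"
    then have "p k dvd q"
      unfolding q_def by (intro dvd_prodI) auto
    then have "p k dvd K"
      by (simp add: K_def)
    then have dv: "P k dvd int K * z" for z
      by simp
    have zero: "h j = 0" if "modulus j = p k" for j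
    proof -
      have "P k dvd int (h j)"
        using h(2)[of j] dv that cong_dvd_iff by metis
      then show ?thesis
        using carrierD[OF hc, of j] that by (auto dest: nat_dvd_not_less)
    qed
    show "vanishes k h"
      unfolding vanishes_def by (simp add: zero)
  next
    have "[int (h j) = a * int (f j)] (mod P n)" if "modulus j = p n" for j
      using cong_trans[OF h(2)[of j, unfolded that] cong_scalar_right[OF K]] .
    then show "[u n h = a * u n f] (mod P n)" "[v n h = a * v n f] (mod P n)" "[w n h = a * w n f] (mod P n)"
      by simp_all
  qed
qed

text \<open>With \<open>z\<close> written as the quotient of \<open>x y\<close> by
  \<open>y x\<close>, its coordinates follow by comparing \<open>z (y x)\<close> with
  \<open>x y\<close>, without computing digits of inverses.\<close>

lemma sq_commutator:
  assumes x: "x \<in> carrier G" and y: "y \<in> carrier G"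
  defines "z \<equiv> x \<otimes>\<^bsub>G\<^esub> y \<otimes>\<^bsub>G\<^esub> inv\<^bsub>G\<^esub> (y \<otimes>\<^bsub>G\<^esub> x)"
  shows "x \<otimes>\<^bsub>G\<^esub> x \<in> untwisted_part" "z \<in> untwisted_part"
    "P n dvd u n z" "P n dvd v n z" "[w n z = comm n x y] (mod P n)"
proof -
  show "x \<otimes>\<^bsub>G\<^esub> x \<in> untwisted_part"
    by (auto simp: untwisted_part_def mult_carrier mult_binary simp flip: mult_2)
  have "z = x \<otimes>\<^bsub>G\<^esub> y \<otimes>\<^bsub>G\<^esub> inv\<^bsub>G\<^esub> x \<otimes>\<^bsub>G\<^esub> inv\<^bsub>G\<^esub> y"
    using x y by (simp add: z_def inv_mult_group m_assoc)
  then show z: "z \<in> untwisted_part"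
    using commutator_untwisted[OF x y] by simp
  have eq: "z \<otimes>\<^bsub>G\<^esub> (y \<otimes>\<^bsub>G\<^esub> x) = x \<otimes>\<^bsub>G\<^esub> y"
    using x y by (simp add: z_def m_assoc)
  have "[u n z + (u n y + u n x) = u n z + u n (y \<otimes>\<^bsub>G\<^esub> x)] (mod P n)"
    using u_mult[of y x n] by (intro cong_add cong_refl) (rule cong_sym)
  also have "[u n z + u n (y \<otimes>\<^bsub>G\<^esub> x) = u n (x \<otimes>\<^bsub>G\<^esub> y)] (mod P n)"
    using untwisted_uvw_mult(1)[OF z, of "y \<otimes>\<^bsub>G\<^esub> x" n] unfolding eq by (rule cong_sym)
  also note u_mult[of x y n]
  finally show "P n dvd u n z"
    by (simp add: cong_iff_dvd_diff algebra_simps)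
  have "[v n z + (v n y + v n x) = v n z + v n (y \<otimes>\<^bsub>G\<^esub> x)] (mod P n)"
    using v_mult[of y x n] by (intro cong_add cong_refl) (rule cong_sym)
  also have "[v n z + v n (y \<otimes>\<^bsub>G\<^esub> x) = v n (x \<otimes>\<^bsub>G\<^esub> y)] (mod P n)"
    using untwisted_uvw_mult(2)[OF z, of "y \<otimes>\<^bsub>G\<^esub> x" n] unfolding eq by (rule cong_sym)
  also note v_mult[of x y n]
  finally show "P n dvd v n z"
    by (simp add: cong_iff_dvd_diff algebra_simps)
  have "[w n z + (w n y + twist (e n) y * w n x) = w n z + w n (y \<otimes>\<^bsub>G\<^esub> x)] (mod P n)"
    using w_mult[of y x n] by (intro cong_add cong_refl) (rule cong_sym)
  also have "[w n z + w n (y \<otimes>\<^bsub>G\<^esub> x) = w n (x \<otimes>\<^bsub>G\<^esub> y)] (mod P n)"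
    using untwisted_uvw_mult(3)[OF z, of "y \<otimes>\<^bsub>G\<^esub> x" n] unfolding eq by (rule cong_sym)
  also note w_mult[of x y n]
  finally show "[w n z = comm n x y] (mod P n)"
    by (simp add: cong_iff_dvd_diff comm_def algebra_simps)
qed

text \<open>The squares of \<open>x\<close> and \<open>y\<close> reach all values of \<open>u, v\<close>, and the commutator corrects \<open>w\<close>.\<close>

lemma reach_block:
  assumes H: "subgroup H G" and x: "x \<in> H" and y: "y \<in> H" and g: "g \<in> carrier G"
    and good: "\<not> P n dvd det n x y" "\<not> P n dvd comm n x y"
  shows "\<exists>h\<in>H \<inter> untwisted_part. (\<forall>k<M. k \<noteq> n \<longrightarrow> vanishes k h) \<and> agrees n h g"
proof -
  interpret H: subgroup H G
    by (rule H)
  have xc: "x \<in> carrier G" and yc: "y \<in> carrier G"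
    using x y H.subset by auto
  define z where "z = x \<otimes>\<^bsub>G\<^esub> y \<otimes>\<^bsub>G\<^esub> inv\<^bsub>G\<^esub> (y \<otimes>\<^bsub>G\<^esub> x)"
  let ?xx = "x \<otimes>\<^bsub>G\<^esub> x" and ?yy = "y \<otimes>\<^bsub>G\<^esub> y"
  have in_H: "?xx \<in> H" "?yy \<in> H" "z \<in> H"
    using x y by (auto simp: z_def)
  note untw = sq_commutator(1)[OF xc xc] sq_commutator(1)[OF yc yc] sq_commutator(2)[OF xc yc, folded z_def]
  note z = sq_commutator(3-5)[OF xc yc, of n, folded z_def]
  \<comment> \<open>Squaring doubles u and v, so the determinant is multiplied by 4, a unit mod
    p.\<close>
  have "[u n ?xx * v n ?yy - v n ?xx * u n ?yy =
      (u n x + u n x) * (v n y + v n y) - (v n x + v n x) * (u n y + u n y)] (mod P n)"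
    by (intro cong_diff cong_mult u_mult v_mult)
  also have "(u n x + u n x) * (v n y + v n y) - (v n x + v n x) * (u n y + u n y) = 4 * det n x y"
    by (simp add: det_def algebra_simps)
  finally have "P n dvd u n ?xx * v n ?yy - v n ?xx * u n ?yy \<longleftrightarrow> P n dvd 4 * det n x y"
    by (rule cong_dvd_iff)
  then have "\<not> P n dvd u n ?xx * v n ?yy - v n ?xx * u n ?yy"
    using good(1) not_P_dvd_small[of 4 n] by (simp add: prime_dvd_mult_iff[OF prime_P])
  then obtain i j where ij: "[i * u n ?xx + j * u n ?yy = u n g] (mod P n)"
      "[i * v n ?xx + j * v n ?yy = v n g] (mod P n)"
    by (rule solve_2x2_cong[OF prime_P])
  have "\<not> P n dvd w n z"
    using z(3) good(2) cong_dvd_iff by blast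
  then obtain k where k: "[k * w n z = w n g - (i * w n ?xx + j * w n ?yy)] (mod P n)"
    by (rule solve_cong[OF prime_P])
  obtain hx where hx: "hx \<in> H" "hx \<in> untwisted_part" "\<And>k. k < M \<Longrightarrow> k \<noteq> n \<Longrightarrow> vanishes k hx"
    "[u n hx = i * u n ?xx] (mod P n)" "[v n hx = i * v n ?xx] (mod P n)" "[w n hx = i * w n ?xx] (mod P n)"
    using isolate[OF H in_H(1) untw(1), of M n i] by blast
  obtain hy where hy: "hy \<in> H" "hy \<in> untwisted_part" "\<And>k. k < M \<Longrightarrow> k \<noteq> n \<Longrightarrow> vanishes k hy"
    "[u n hy = j * u n ?yy] (mod P n)" "[v n hy = j * v n ?yy] (mod P n)" "[w n hy = j * w n ?yy] (mod P n)"
    using isolate[OF H in_H(2) untw(2), of M n j] by blast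
  obtain hz where hz: "hz \<in> H" "hz \<in> untwisted_part" "\<And>k. k < M \<Longrightarrow> k \<noteq> n \<Longrightarrow> vanishes k hz"
    "[u n hz = k * u n z] (mod P n)" "[v n hz = k * v n z] (mod P n)" "[w n hz = k * w n z] (mod P n)"
    using isolate[OF H in_H(3) untw(3), of M n k] by blast
  define h where "h = hx \<otimes>\<^bsub>G\<^esub> (hy \<otimes>\<^bsub>G\<^esub> hz)"
  have sum3: "[s + (s' + s'') = r + (r' + r'')] (mod P n)"
    if "[s = r] (mod P n)" "[s' = r'] (mod P n)" "[s'' = r''] (mod P n)" for s s' s'' r r' r''
    using that by (intro cong_add)
  have "[u n h = u n hx + (u n hy + u n hz)] (mod P n)"
    unfolding h_def
    using cong_trans[OF untwisted_uvw_mult(1)[OF hx(2), of "hy \<otimes>\<^bsub>G\<^esub> hz" n]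
        cong_add[OF cong_refl untwisted_uvw_mult(1)[OF hy(2), of hz n]]] .
  also note sum3[OF hx(4) hy(4) hz(4)]
  also have "[i * u n ?xx + (j * u n ?yy + k * u n z) = i * u n ?xx + j * u n ?yy] (mod P n)"
    using z(1) by (simp add: cong_iff_dvd_diff)
  also note ij(1)
  finally have hu: "[u n h = u n g] (mod P n)" .
  have "[v n h = v n hx + (v n hy + v n hz)] (mod P n)"
    unfolding h_def
    using cong_trans[OF untwisted_uvw_mult(2)[OF hx(2), of "hy \<otimes>\<^bsub>G\<^esub> hz" n]
        cong_add[OF cong_refl untwisted_uvw_mult(2)[OF hy(2), of hz n]]] .
  also note sum3[OF hx(5) hy(5) hz(5)]
  also have "[i * v n ?xx + (j * v n ?yy + k * v n z) = i * v n ?xx + j * v n ?yy] (mod P n)"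
    using z(2) by (simp add: cong_iff_dvd_diff)
  also note ij(2)
  finally have hv: "[v n h = v n g] (mod P n)" .
  have "[w n h = w n hx + (w n hy + w n hz)] (mod P n)"
    unfolding h_def
    using cong_trans[OF untwisted_uvw_mult(3)[OF hx(2), of "hy \<otimes>\<^bsub>G\<^esub> hz" n]
        cong_add[OF cong_refl untwisted_uvw_mult(3)[OF hy(2), of hz n]]] .
  also note sum3[OF hx(6) hy(6) hz(6)]
  also have "[i * w n ?xx + (j * w n ?yy + k * w n z) = w n g] (mod P n)"
    using k by (simp add: cong_iff_dvd_diff algebra_simps)
  finally have hw: "[w n h = w n g] (mod P n)" .
  have hH: "h \<in> H" "h \<in> untwisted_part"
    using hx hy hz by (auto simp: h_def mult_untwisted)
  have "h (U n) = g (U n)" "h (V n) = g (V n)" "h (W n) = g (W n)"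
    using hu hv hw carrierD[OF g, of "U n"] carrierD[OF g, of "V n"] carrierD[OF g, of "W n"]
      carrierD[OF H.mem_carrier[OF hH(1)], of "U n"] carrierD[OF H.mem_carrier[OF hH(1)], of "V n"]
      carrierD[OF H.mem_carrier[OF hH(1)], of "W n"]
    by (simp_all add: cong_def)
  then have "agrees n h g"
    by (simp add: agrees_def)
  moreover have "\<forall>k<M. k \<noteq> n \<longrightarrow> vanishes k h"
    unfolding h_def using hx hy hz by (intro allI impI vanishes_mult) auto
  ultimately show ?thesis
    using hH by blast
qed

text \<open>An element vanishing on the bits and on the blocks below \<open>N\<close> is a limit of
  elements of the generated subgroup, built by correcting the blocks from \<open>N\<close> on
  successively with \<open>reach_block\<close>.\<close>

lemma open_if:
  assumes xy: "x \<in> carrier G" "y \<in> carrier G"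
    and good: "\<And>n. n \<ge> N \<Longrightarrow> \<not> P n dvd det n x y \<and> \<not> P n dvd comm n x y"
  shows "openin T (closed_generate G T {x, y})"
proof -
  define H where "H = generate G {x, y}"
  have H: "subgroup H G"
    unfolding H_def using xy by (intro generate_is_subgroup) auto
  have in_H: "x \<in> H" "y \<in> H"
    by (auto simp: H_def intro: generate.incl)
  have HG: "H \<subseteq> carrier G"
    by (rule subgroup.subset[OF H])
  have "g \<in> closed_generate G T {x, y}" if g: "g \<in> carrier G" "\<forall>j<W N. g j = 0" for g
  proof -
    have vanish: "vanishes n g" if "n < N" for n
      using that g(2) by (simp add: vanishes_def U_def V_def W_def)
    \<comment> \<open>Blocks from \<open>L\<close> to \<open>M\<close> are kept at zero, and each
      correction vanishes on every other block below \<open>M\<close>; hence a correction at block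
      \<open>L\<close> leaves the finished blocks alone.\<close>
    have blocks: "\<exists>h\<in>H \<inter> untwisted_part. \<forall>k<M. if k < L then agrees k h g else vanishes k h"
      if "L \<le> M" for L M
      using that
    proof (induction L)
      case 0
      have "\<one>\<^bsub>G\<^esub> \<in> H \<inter> untwisted_part"
        using subgroup.one_closed[OF H] subgroup.one_closed[OF subgroup_untwisted] by blast
      then show ?case
        by (intro bexI[of _ "\<one>\<^bsub>G\<^esub>"]) (auto simp: vanishes_def one_eq)
    next
      case (Suc L)
      then obtain h where h: "h \<in> H" "h \<in> untwisted_part"
          "\<And>k. k < M \<Longrightarrow> if k < L then agrees k h g else vanishes k h"
        by auto
      show ?case
      proof (cases "L < N")
        case True
        then have "agrees L h g"
          using h(3)[of L] Suc.prems vanish[of L] by (simp add: agrees_def vanishes_def)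
        with h show ?thesis
          by (intro bexI[of _ h]) (auto simp: less_Suc_eq split: if_splits)
      next
        case False
        then obtain h' where h': "h' \<in> H" "h' \<in> untwisted_part"
            "\<And>k. k < M \<Longrightarrow> k \<noteq> L \<Longrightarrow> vanishes k h'" "agrees L h' g"
          using reach_block[OF H in_H g(1), of L M] good[of L] by auto
        have "if k < Suc L then agrees k (h \<otimes>\<^bsub>G\<^esub> h') g else vanishes k (h \<otimes>\<^bsub>G\<^esub> h')" if k: "k < M" for k
        proof (cases "k = L")
          case True
          then have "agrees k (h \<otimes>\<^bsub>G\<^esub> h') h'"
            using h h' HG k by (intro agrees_mult_vanishes) (auto dest: h(3))
          with h'(4) True show ?thesis
            by (simp add: agrees_def)
        next
          case False
          then have "vanishes k h'"
            using h'(3) k by blast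
          moreover have "agrees k (h \<otimes>\<^bsub>G\<^esub> h') h"
            using h h' HG k calculation by (intro agrees_mult_vanishes) auto
          ultimately show ?thesis
            using h(3)[OF k] False by (auto simp: agrees_def vanishes_def split: if_splits)
        qed
        then show ?thesis
          using h h' subgroup.m_closed[OF H] mult_untwisted
          by (intro bexI[of _ "h \<otimes>\<^bsub>G\<^esub> h'"]) auto
      qed
    qed
    \<comment> \<open>The first \<open>M\<close> digits are covered by the bits and the first
      \<open>M\<close> blocks, since the digits of block \<open>n\<close> have index at least
      \<open>n\<close>.\<close>
    have "\<exists>h\<in>H. \<forall>j<M. h j = g j" for M
    proof -
      obtain h where h: "h \<in> H" "h \<in> untwisted_part" "\<forall>k<M. agrees k h g"
        using blocks[of M M] by auto
      have "h j = g j" if "j < M" for j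
      proof (cases j rule: coord_cases)
        case 1
        then show ?thesis
          using h(2) g(2) by (simp add: untwisted_part_def W_def)
      qed (use h(3) that UVW_ge in \<open>auto simp: agrees_def dest: order.strict_trans1[OF UVW_ge(1)] order.strict_trans1[OF UVW_ge(2)] order.strict_trans1[OF UVW_ge(3)]\<close>)
      with h(1) show ?thesis
        by blast
    qed
    with g(1) show ?thesis
      unfolding closed_generate_def H_def[symmetric] closure_of_T_iff[OF HG] by blast
  qed
  then show ?thesis
    using xy by (subst openin_closed_generate_iff) blast+
qed

end

section \<open>The virtually generating graph\<close>

definition open_pair :: "('a, 'b) monoid_scheme \<Rightarrow> 'a topology \<Rightarrow> 'a \<Rightarrow> 'a \<Rightarrow> bool" where
  "open_pair G T x y \<longleftrightarrow> x \<in> carrier G \<and> y \<in> carrier G \<and> x \<noteq> y \<and>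
     openin T (closed_generate G T {x, y})"

lemma open_pair_sym: "open_pair G T x y \<Longrightarrow> open_pair G T y x"
  by (auto simp: open_pair_def insert_commute)

lemma arcs_ends_virt_generating_graph:
  "(x, y) \<in> arcs_ends (virt_generating_graph G T) \<longleftrightarrow> open_pair G T x y"
  by (auto simp: virt_generating_graph_def arcs_ends_def arc_to_ends_def open_pair_def)

lemma verts_reduced:
  "verts (reduced_virt_generating_graph G T) = {x. \<exists>y. open_pair G T x y}"
  unfolding reduced_virt_generating_graph_def Let_def induce_subgraph_verts isolated_verts_def
    arcs_ends_virt_generating_graph
  by (auto simp: virt_generating_graph_def dest: open_pair_sym) (auto simp: open_pair_def)

text \<open>Adjacency is symmetric, so both ends of an arc are non-isolated and no arc is lost by
  the reduction.\<close>

lemma arcs_ends_reduced: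
  "(x, y) \<in> arcs_ends (reduced_virt_generating_graph G T) \<longleftrightarrow> open_pair G T x y"
proof -
  have "(x, y) \<in> arcs_ends (reduced_virt_generating_graph G T) \<longleftrightarrow>
      (x, y) \<in> arcs_ends (virt_generating_graph G T) \<and>
      x \<in> verts (reduced_virt_generating_graph G T) \<and> y \<in> verts (reduced_virt_generating_graph G T)"
    by (auto simp: reduced_virt_generating_graph_def Let_def induce_subgraph_def arcs_ends_def
        arc_to_ends_def)
  then show ?thesis
    unfolding arcs_ends_virt_generating_graph verts_reduced by (auto dest: open_pair_sym)
qed

lemma wf_reduced: "wf_digraph (reduced_virt_generating_graph G T)"
  by unfold_locales (auto simp: reduced_virt_generating_graph_def Let_def induce_subgraph_def)

section \<open>Parities, blocks and avoidance of lines\<close>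

lemma twist_eq_1_iff: "twist A x = 1 \<longleftrightarrow> even (sum x A)"
  unfolding twist_def power_sum[symmetric] by (cases "even (sum x A)") auto

text \<open>Converse of \<open>exists_same_block\<close>: only block \<open>i\<close> contributes to
  the parities, and there \<open>A\<close> is a nonzero linear form, which cannot vanish on two
  independent vectors of a plane.\<close>

lemma same_block_transversal:
  assumes "same_block t x y i" "A \<in> transversals t"
  shows "odd (sum x A) \<or> odd (sum y A)"
proof -
  let ?B = "A \<inter> {2 * i, 2 * i + 1}"
  have i: "i < t" and fin: "finite A"
    using assms by (auto simp: same_block_def transversals_def intro: finite_subset)
  have rest: "even (x j) \<and> even (y j)" if "j \<in> A - ?B" for j
  proof -
    have "j < 2 * t" "j div 2 \<noteq> i"
      using that assms(2) by (auto simp: transversals_def)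
    then show ?thesis
      using assms(1) by (simp add: same_block_def)
  qed
  have split: "sum f A = sum f (A - ?B) + sum f ?B" for f :: "nat \<Rightarrow> nat"
    using fin by (intro sum.subset_diff) auto
  have "even (sum x (A - ?B))" "even (sum y (A - ?B))"
    using rest by (auto intro: dvd_sum)
  then have "odd (sum x A) \<longleftrightarrow> odd (sum x ?B)" "odd (sum y A) \<longleftrightarrow> odd (sum y ?B)"
    by (simp_all add: split[of x] split[of y])
  moreover have "?B = {2 * i} \<or> ?B = {2 * i + 1} \<or> ?B = {2 * i, 2 * i + 1}"
    using assms(2) i by (auto simp: transversals_def)
  moreover have "odd (x (2 * i) * y (2 * i + 1) + x (2 * i + 1) * y (2 * i))"
    using assms(1) by (simp add: same_block_def)
  ultimately show ?thesis
    by (elim disjE) auto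
qed

definition supported :: "nat \<Rightarrow> nat \<Rightarrow> (nat \<Rightarrow> nat) \<Rightarrow> bool" where
  "supported t i x \<longleftrightarrow> i < t \<and> (\<forall>j<2 * t. j div 2 \<noteq> i \<longrightarrow> even (x j)) \<and>
     (odd (x (2 * i)) \<or> odd (x (2 * i + 1)))"

lemma same_block_supported: "same_block t x y i \<Longrightarrow> supported t i x \<and> supported t i y"
  unfolding same_block_def supported_def by auto

text \<open>Digits from \<open>2 * t\<close> on are not bits and may be odd, so the index need not
  be unique. For a supported element the least one is the right one, because its block lies below
  \<open>t\<close>.\<close>

definition block :: "(nat \<Rightarrow> nat) \<Rightarrow> nat" where
  "block x = (LEAST i. odd (x (2 * i)) \<or> odd (x (2 * i + 1)))"

lemma block_eq: "supported t i x \<Longrightarrow> block x = i"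
  unfolding block_def supported_def
proof (rule Least_equality)
  fix k assume x: "i < t \<and> (\<forall>j<2 * t. j div 2 \<noteq> i \<longrightarrow> even (x j)) \<and>
      (odd (x (2 * i)) \<or> odd (x (2 * i + 1)))" and k: "odd (x (2 * k)) \<or> odd (x (2 * k + 1))"
  show "i \<le> k"
  proof (rule ccontr)
    assume "\<not> i \<le> k"
    with x have "even (x (2 * k))" "even (x (2 * k + 1))"
      by auto
    with k show False
      by blast
  qed
qed auto

text \<open>Any two of the vectors (1,0), (0,1), (1,1) have determinant 1 or -1, so each line
  contains at most one of the three, and two lines leave one of them free.\<close>

lemma avoid_two_lines:
  fixes q :: int
  assumes "\<not> q dvd a \<or> \<not> q dvd b" "\<not> q dvd c \<or> \<not> q dvd d"
  shows "\<exists>r s. r \<le> 1 \<and> s \<le> 1 \<and> \<not> q dvd a * int s - b * int r \<and> \<not> q dvd c * int s - d * int r"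
proof -
  define Q where "Q r s \<longleftrightarrow> \<not> q dvd a * int s - b * int r \<and> \<not> q dvd c * int s - d * int r" for r s
  have "q dvd b" if "q dvd a" "q dvd a - b"
    using dvd_diff[OF that] by simp
  moreover have "q dvd a" if "q dvd b" "q dvd a - b"
    using dvd_add[OF that] by simp
  moreover have "q dvd d" if "q dvd c" "q dvd c - d"
    using dvd_diff[OF that] by simp
  moreover have "q dvd c" if "q dvd d" "q dvd c - d"
    using dvd_add[OF that] by simp
  ultimately have "Q 1 0 \<or> Q 0 1 \<or> Q 1 1"
    using assms unfolding Q_def by auto
  then show ?thesis
    unfolding Q_def[symmetric] by (elim disjE) (blast intro: le_refl zero_le)+
qed

section \<open>Adjacency, common neighbours and the number of components\<close>

context block_product
begin

text \<open>The conditions that an arc imposes on each of its ends separately. They turn out to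
  characterise the non-isolated vertices.\<close>

definition admissible :: "nat \<Rightarrow> (nat \<Rightarrow> nat) \<Rightarrow> bool" where
  "admissible i x \<longleftrightarrow> x \<in> carrier G \<and> supported t i x \<and>
     (\<exists>N. \<forall>n\<ge>N. (\<not> P n dvd u n x \<or> \<not> P n dvd v n x) \<and> (twist (e n) x = 1 \<longrightarrow> \<not> P n dvd w n x))"

text \<open>\<open>open_imp\<close> is applied in both orders because its condition on w concerns
  the first element only.\<close>

lemma open_pair_admissible:
  assumes "open_pair G T x y"
  shows "\<exists>i. admissible i x \<and> admissible i y"
proof -
  have xy: "x \<in> carrier G" "y \<in> carrier G"
    and op: "openin T (closed_generate G T {x, y})" "openin T (closed_generate G T {y, x})"
    using assms open_pair_sym[OF assms] by (auto simp: open_pair_def)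
  obtain N where N: "\<And>n. n \<ge> N \<Longrightarrow> \<not> P n dvd det n x y \<and> \<not> (twist (e n) x = 1 \<and> twist (e n) y = 1) \<and>
      (twist (e n) x = 1 \<longrightarrow> \<not> P n dvd w n x)"
    using open_imp[OF xy op(1)] by blast
  obtain N' where N': "\<And>n. n \<ge> N' \<Longrightarrow> twist (e n) y = 1 \<longrightarrow> \<not> P n dvd w n y"
    using open_imp[OF xy(2,1) op(2)] by blast
  \<comment> \<open>\<open>A\<close> recurs as some \<open>e n\<close> with \<open>n\<close> at
    least \<open>N\<close>, where the character may not be trivial on both elements.\<close>
  have "odd (sum x A) \<or> odd (sum y A)" if "A \<in> transversals t" for A
    using e_recurrent[OF that, of N] N by (auto simp: twist_eq_1_iff)
  then obtain i where "same_block t x y i"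
    using exists_same_block by blast
  then have supp: "supported t i x" "supported t i y"
    using same_block_supported by auto
  have det: "(\<not> P n dvd u n x \<or> \<not> P n dvd v n x) \<and> (\<not> P n dvd u n y \<or> \<not> P n dvd v n y)" if "n \<ge> N" for n
  proof (rule ccontr)
    assume "\<not> ?thesis"
    then have "P n dvd det n x y"
      unfolding det_def by (intro dvd_diff) auto
    with N[OF that] show False
      by blast
  qed
  have "admissible i x"
    unfolding admissible_def using xy supp det N by blast
  moreover have "admissible i y"
    unfolding admissible_def using xy supp det N'
    by (intro conjI exI[of _ "max N N'"]) auto
  ultimately show ?thesis
    by blast
qed

text \<open>By the signs of \<open>x\<close> and \<open>y\<close>, which are not both 1, the
  commutator term is 2 w(x), -2 w(y) or 2 (w(x) - w(y)). The hypotheses make each of these nonzero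
  mod p where it occurs.\<close>

lemma open_pairI:
  assumes x: "x \<in> carrier G" "\<And>n. n \<ge> N \<Longrightarrow> twist (e n) x = 1 \<longrightarrow> \<not> P n dvd w n x"
    and y: "y \<in> carrier G" "\<And>n. y (W n) \<in> {1, 2, 3}" "\<And>n. n \<ge> N \<Longrightarrow> y (W n) \<noteq> x (W n)"
    and bits: "same_block t x y i" and det: "\<And>n. n \<ge> N \<Longrightarrow> \<not> P n dvd det n x y"
  shows "open_pair G T x y"
proof -
  have "\<not> P n dvd comm n x y" if n: "n \<ge> N" for n
  proof -
    have two: "P n dvd 2 * z \<longleftrightarrow> P n dvd z" for z
      using not_P_dvd_small[of 2 n] by (simp add: prime_dvd_mult_iff[OF prime_P])
    have "\<not> P n dvd w n y"
      by (rule not_P_dvd_small) (use y(2)[of n] in auto)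
    moreover have "\<not> P n dvd w n x - w n y"
    proof
      assume "P n dvd w n x - w n y"
      then have "[x (W n) = y (W n)] (mod p n)"
        by (simp add: cong_iff_dvd_diff flip: cong_int_iff)
      then show False
        using y(3)[OF n] carrierD[OF x(1), of "W n"] carrierD[OF y(1), of "W n"] by (simp add: cong_def)
    qed
    moreover have "\<not> (twist (e n) x = 1 \<and> twist (e n) y = 1)"
      using same_block_transversal[OF bits e_transversal] by (auto simp: twist_eq_1_iff)
    moreover have "2 * w n x - 2 * w n y = 2 * (w n x - w n y)"
      by simp
    ultimately show ?thesis
      using x(2)[OF n] twist_cases[of "e n" x] twist_cases[of "e n" y]
      unfolding comm_def by (auto simp: two simp del: right_diff_distrib_numeral)
  qed
  then have "openin T (closed_generate G T {x, y})"
    using x(1) y(1) det by (intro open_if) auto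
  moreover have "x \<noteq> y"
    using y(3)[of N] by auto
  ultimately show ?thesis
    using x(1) y(1) by (simp add: open_pair_def)
qed

text \<open>The neighbour is chosen digit by digit: u, v off two lines, w in {1, 2, 3} different
  from two values, and the bits in block \<open>i\<close> independent of those of \<open>x\<close>
  and of \<open>x'\<close>.\<close>

lemma common_neighbour:
  assumes x: "admissible i x" and x': "admissible i x'"
  shows "\<exists>y. open_pair G T x y \<and> open_pair G T x' y"
proof -
  from x have xc: "x \<in> carrier G" and xs: "supported t i x"
    unfolding admissible_def by auto
  from x' have xc': "x' \<in> carrier G" and xs': "supported t i x'"
    unfolding admissible_def by auto
  from x obtain N where N: "\<And>n. n \<ge> N \<Longrightarrow> (\<not> P n dvd u n x \<or> \<not> P n dvd v n x) \<and>
      (twist (e n) x = 1 \<longrightarrow> \<not> P n dvd w n x)"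
    unfolding admissible_def by auto
  from x' obtain N' where N': "\<And>n. n \<ge> N' \<Longrightarrow> (\<not> P n dvd u n x' \<or> \<not> P n dvd v n x') \<and>
      (twist (e n) x' = 1 \<longrightarrow> \<not> P n dvd w n x')"
    unfolding admissible_def by auto
  define M where "M = max N N'"
  have "\<exists>r s. r \<le> 1 \<and> s \<le> 1 \<and> (n \<ge> M \<longrightarrow>
    \<not> P n dvd u n x * int s - v n x * int r \<and> \<not> P n dvd u n x' * int s - v n x' * int r)" for n
  proof (cases "n \<ge> M")
    case True
    then show ?thesis
      using avoid_two_lines[of "P n" "u n x" "v n x" "u n x'" "v n x'"] N[of n] N'[of n]
      by (auto simp: M_def)
  next
    case False
    then show ?thesis
      using le_refl by blast
  qed
  then obtain r s where rs: "\<And>n. r n \<le> (1 :: nat)" "\<And>n. s n \<le> (1 :: nat)"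
      "\<And>n. n \<ge> M \<Longrightarrow> \<not> P n dvd u n x * int (s n) - v n x * int (r n)"
      "\<And>n. n \<ge> M \<Longrightarrow> \<not> P n dvd u n x' * int (s n) - v n x' * int (r n)"
    by metis
  have "\<exists>k. k \<in> {1, 2, 3} \<and> k \<noteq> x (W n) \<and> k \<noteq> x' (W n)" for n
  proof -
    have "(1 \<noteq> a \<and> 1 \<noteq> b) \<or> (2 \<noteq> a \<and> 2 \<noteq> b) \<or> (3 \<noteq> a \<and> 3 \<noteq> b)" for a b :: nat
      by arith
    then show ?thesis
      by blast
  qed
  then obtain k where k: "\<And>n. k n \<in> {1, 2, 3}" "\<And>n. k n \<noteq> x (W n)" "\<And>n. k n \<noteq> x' (W n)"
    by metis
  \<comment> \<open>The same choice over the field with two elements: one of the three nonzero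
    vectors differs from the bit vectors of both \<open>x\<close> and \<open>x'\<close>, and
    distinct nonzero vectors are independent there.\<close>
  have bits: "\<exists>\<beta> \<beta>'. \<beta> \<le> 1 \<and> \<beta>' \<le> 1 \<and> odd (x (2 * i) * \<beta>' + x (2 * i + 1) * \<beta>) \<and>
      odd (x' (2 * i) * \<beta>' + x' (2 * i + 1) * \<beta>)"
  proof -
    define Q where "Q \<beta> \<beta>' \<longleftrightarrow> odd (x (2 * i) * \<beta>' + x (2 * i + 1) * \<beta>) \<and>
      odd (x' (2 * i) * \<beta>' + x' (2 * i + 1) * \<beta>)" for \<beta> \<beta>'
    have "Q 1 0 \<or> Q 0 1 \<or> Q 1 1"
      using xs xs' unfolding supported_def Q_def by auto
    then show ?thesis
      unfolding Q_def[symmetric] by (elim disjE) (blast intro: le_refl zero_le)+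
  qed
  then obtain \<beta> \<beta>' where \<beta>: "\<beta> \<le> 1" "\<beta>' \<le> 1" "odd (x (2 * i) * \<beta>' + x (2 * i + 1) * \<beta>)"
      "odd (x' (2 * i) * \<beta>' + x' (2 * i + 1) * \<beta>)"
    by blast
  define y where "y = (\<lambda>j. if j < 2 * t then (if j = 2 * i then \<beta> else if j = 2 * i + 1 then \<beta>' else 0)
    else if (j - 2 * t) mod 3 = 0 then r ((j - 2 * t) div 3)
    else if (j - 2 * t) mod 3 = 1 then s ((j - 2 * t) div 3)
    else k ((j - 2 * t) div 3))"
  have yu: "y (U n) = r n" and yv: "y (V n) = s n" and yw: "y (W n) = k n" for n
    by (simp_all add: y_def U_def V_def W_def)
  have i: "i < t"
    using xs by (simp add: supported_def)
  have yb: "y (2 * i) = \<beta>" "y (2 * i + 1) = \<beta>'" "\<And>j. j < 2 * t \<Longrightarrow> j div 2 \<noteq> i \<Longrightarrow> y j = 0"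
    using i by (auto simp: y_def)
  have yc: "y \<in> carrier G"
    unfolding carrier_iff
  proof
    fix j
    show "y j < modulus j"
    proof (cases j rule: coord_cases)
      case 1
      then show ?thesis
        using \<beta> by (simp add: y_def modulus_def)
    next
      case (2 n)
      then show ?thesis
        using rs(1)[of n] p_ge_5[of n] yu[of n] by simp
    next
      case (3 n)
      then show ?thesis
        using rs(2)[of n] p_ge_5[of n] yv[of n] by simp
    next
      case (4 n)
      then show ?thesis
        using k(1)[of n] p_ge_5[of n] yw[of n] by auto
    qed
  qed
  have sb: "same_block t x y i" "same_block t x' y i"
    using xs xs' yb \<beta>(3,4) unfolding same_block_def supported_def by auto
  have "open_pair G T x y"
    by (rule open_pairI[where N = M, OF xc _ yc _ _ sb(1)])
      (use N k rs(3) in \<open>auto simp: M_def yu yv yw det_def\<close>)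
  moreover have "open_pair G T x' y"
    by (rule open_pairI[where N = M, OF xc' _ yc _ _ sb(2)])
      (use N' k rs(4) in \<open>auto simp: M_def yu yv yw det_def\<close>)
  ultimately show ?thesis
    by blast
qed

lemma exists_admissible:
  assumes i: "i < t"
  shows "\<exists>x. admissible i x"
proof -
  \<comment> \<open>A single odd bit places the element in block \<open>i\<close>; the digits 1
    elsewhere make u and w nonzero for every prime.\<close>
  define x :: "nat \<Rightarrow> nat" where "x = (\<lambda>j. if j < 2 * t \<and> j \<noteq> 2 * i then 0 else 1)"
  have "1 < modulus j" for j
    using p_ge_5[of "(j - 2 * t) div 3"] by (simp add: modulus_def)
  then have "x \<in> carrier G"
    using pos by (auto simp: carrier_iff x_def)
  moreover have "supported t i x"
    using i by (auto simp: supported_def x_def)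
  moreover have "x (U n) = 1" "x (W n) = 1" for n
    by (auto simp: x_def U_def W_def)
  ultimately show ?thesis
    using not_P_dvd_small[of 1] by (auto simp: admissible_def)
qed

lemma card_components_G:
  "card (connected_components (reduced_virt_generating_graph G T)) = t"
proof -
  \<comment> \<open>\<open>common_neighbour\<close> applied to an admissible element and itself
    shows that it is not isolated.\<close>
  have verts: "x \<in> verts (reduced_virt_generating_graph G T) \<longleftrightarrow> (\<exists>i. admissible i x)" for x
    unfolding verts_reduced using open_pair_admissible common_neighbour by blast
  have block: "admissible i x \<Longrightarrow> block x = i \<and> i < t" for i x
    unfolding admissible_def using block_eq by (auto simp: supported_def)
  have "card (connected_components (reduced_virt_generating_graph G T)) =
      card (block ` verts (reduced_virt_generating_graph G T))"
  proof (rule card_connected_components[OF wf_reduced])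
    fix x y assume "(x, y) \<in> arcs_ends (reduced_virt_generating_graph G T)"
    then show "block x = block y"
      unfolding arcs_ends_reduced using open_pair_admissible block by metis
  next
    fix x y assume "x \<in> verts (reduced_virt_generating_graph G T)"
      "y \<in> verts (reduced_virt_generating_graph G T)" "block x = block y"
    then show "\<exists>z. (x, z) \<in> arcs_ends (reduced_virt_generating_graph G T) \<and>
        (y, z) \<in> arcs_ends (reduced_virt_generating_graph G T)"
      unfolding verts arcs_ends_reduced using block common_neighbour by metis
  qed
  also have "block ` verts (reduced_virt_generating_graph G T) = {..<t}"
    using block exists_admissible verts by (auto simp: image_iff) metis
  finally show ?thesis
    by simp
qed

lemma topologically_fin_gen_block_product:
  assumes "1 \<le> t"
  shows "topologically_fin_gen G T"
proof -
  \<comment> \<open>Since \<open>t\<close> is positive, block 0 supplies an arc, and its two ends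
    generate an open subgroup.\<close>
  obtain x y where "open_pair G T x y"
    using exists_admissible[of 0] common_neighbour assms by fastforce
  then show ?thesis
    by (intro topologically_fin_gen_G[of "{x, y}"]) (auto simp: open_pair_def)
qed

end

section \<open>Existence of the primes and of a recurrent enumeration of the transversals\<close>

lemma exists_block_product: "\<exists>p e. block_product t p e"
proof -
  define S where "S = {q :: nat. Factorial_Ring.prime q \<and> 5 \<le> q}"
  have "infinite S"
  proof
    assume "finite S"
    then have "finite (S \<union> {..<5})"
      by simp
    moreover have "{q :: nat. Factorial_Ring.prime q} \<subseteq> S \<union> {..<5}"
      by (auto simp: S_def)
    ultimately show False
      using primes_infinite finite_subset by blast
  qed
  have fin: "finite (transversals t)" 
    by (rule finite_subset[of _ "Pow {..<2 * t}"]) (auto simp: transversals_def)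
  have ne: "transversals t \<noteq> {}"
    by (auto simp: transversals_def intro!: exI[of _ "{..<2 * t}"])
  \<comment> \<open>Only the first component of the decoded pair selects the set. The second is
    free, so each set recurs: \<open>prod_encode (a, N)\<close> is at least
    \<open>N\<close>.\<close>
  define e where "e n = from_nat_into (transversals t) (fst (prod_decode n))" for n
  have "block_product t (enumerate S) e"
  proof
    fix n
    show "Factorial_Ring.prime (enumerate S n)" "5 \<le> enumerate S n"
      using enumerate_in_set[OF \<open>infinite S\<close>, of n] by (auto simp: S_def)
    show "e n \<in> transversals t"
      unfolding e_def by (rule from_nat_into[OF ne])
  next
    show "inj (enumerate S)"
      using strict_mono_enumerate[OF \<open>infinite S\<close>] by (rule strict_mono_imp_inj_on)
  next
    fix A N assume A: "A \<in> transversals t"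
    obtain a where "from_nat_into (transversals t) a = A"
      using from_nat_into_surj[OF countable_finite[OF fin] A] by blast
    then show "\<exists>n\<ge>N. e n = A"
      by (intro exI[of _ "prod_encode (a, N)"]) (auto simp: e_def le_prod_encode_2)
  qed
  then show ?thesis
    by blast
qed

theorem theorem1:
  fixes t :: nat
  assumes "t \<ge> 1"
  shows "\<exists>(G :: (nat \<Rightarrow> nat) monoid) (T :: (nat \<Rightarrow> nat) topology).
           prosoluble_group G T \<and> topologically_fin_gen G T \<and>
           card (connected_components (reduced_virt_generating_graph G T)) = t"
proof -
  obtain p e where "block_product t p e"
    using exists_block_product by blast
  then interpret block_product t p e .
  show ?thesis
    using prosoluble_group_G topologically_fin_gen_block_product[OF assms] card_components_G by blast
qed

end
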